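(* Let $\sigma,\tau,\eta$ be as in the context and suppose that $c(z)=c(t,\lambda,z)$ is a $t,\lambda$-dependent polynomial in $z$ of degree $\leq2$. Suppose that the following conditions are satisfied: $$0= \frac{\dot\tau}{\sigma}(z)-\frac{\tau\dot\sigma}{\sigma^2}(z)+ \frac{\frac{c\tau}{\sigma}(z)-\frac{c\tau}{\sigma}(\lambda)-(z-\lambda)\big(\frac{c\tau}{\sigma}\big)'(z)}{(z-\lambda)^2},$$ $$0=-\frac{\dot\sigma}{\sigma}(z)\big(\eta(z)-\eta(\lambda)\big)+\dot\eta(z)-\dot\eta(\lambda)+\frac{\eta(z)-\eta(\lambda)}{z-\lambda}\Big(\frac{c\sigma'}{\sigma}(z)-c'(z)\Big)-\eta'(\lambda)\Big(\frac{\sigma'c}{\sigma}(\lambda)-c'(\lambda)\Big)$$ $$\qquad+\frac{2c\eta(z)-2c\eta(\lambda)-\big((c\eta)'(z)+(c\eta)'(\lambda)\big)(z-\lambda)}{(z-\lambda)^2},$$ $$0= \frac{\dot\sigma}{\sigma}(z)- \frac{\dot\sigma}{\sigma}(\lambda)-\frac{\frac{c\sigma'}{\sigma}(z)-\frac{c\sigma'}{\sigma}(\lambda)-\big(\frac{c\sigma'}{\sigma}\big)'(\lambda)(z-\lambda)}{z-\lambda}.$$ Define the compatibility functions $$a(t,\lambda,z):=\frac{c(z)}{z-\lambda},\qquad b(t,\lambda,\mu,z):=-\frac{c(\lambda)\mu}{z-\lambda}.$$ Then the following equations for $\lambda$, $\mu$ (as functions of $t$) $$\dot\lambda=2 c(\lambda)\mu-c'(\lambda)+\frac{c\tau}{\sigma}(\lambda),$$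 $$\dot\mu=-\frac{c\eta'}{\sigma}(\lambda)-\mu\Big(\frac{c\tau'}{\sigma}(\lambda)-\frac{c\sigma''}{2\sigma}(\lambda)-\frac{c''}{2}\Big)-\mu^2\,\frac{\sigma'c}{\sigma}(\lambda)$$ are equivalent to the compatibility conditions $$\dot p-ap'+2b'-pa'+a''=0,\qquad \dot q+pb'-2qa'-aq'+b''=0,$$ where $$p=\frac{\tau(z)}{\sigma(z)}-\frac{1}{z-\lambda},\qquad q=\frac{1}{\sigma(z)}\Big(\eta(z)-\eta(\lambda)-\mu\big(\tau(\lambda)-\sigma'(\lambda)\big)-\mu^2\sigma(\lambda)+\frac{\mu\sigma(\lambda)}{z-\lambda}\Big).$$
   Context: $\sigma,\tau,\eta$ are rational functions of the complex variable $z$ which depend on a parameter $t$ (the time); $\lambda,\mu$ are additional parameters. A prime denotes $\partial_z$ and a dot denotes $\partial_t$. The symbols $f(\lambda),f'(\lambda),\dot f(\lambda)$ mean that the differentiation with respect to $z$ or $t$ is done first and then $z=\lambda$ is substituted; in particular $c(\lambda)=c(t,\lambda,\lambda)$ and $c'(\lambda)=\partial_zc(t,\lambda,z)|_{z=\lambda}$. Expressions such as $\frac{c\tau}{\sigma}(z)$ or $c\eta(z)$ mean the quotient/product of the functions evaluated at $z$. For $\sigma,\tau,\eta$ the dot acts on their explicit $t$-dependence, whereas in the compatibility conditions $\dot p,\dot q$ denote the $t$-derivatives at fixed $z$ of $p,q$ with $\lambda=\lambda(t)$, $\mu=\mu(t)$ depending on $t$. The compatibility conditions are those of the system $v''+pv'+qv=0$,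 $\dot v=av'+bv$. The equation $v''+pv'+qv=0$ is the deformation, with an additional singularity at $z=\lambda$, of the equation given by $\partial_z^2+\frac{\tau(z)}{\sigma(z)}\partial_z+\frac{\eta(z)}{\sigma(z)}$.
   Formalization: For general rational σ, τ the equations need not imply compatibility (σ=z⁴, τ=η=0, c=z, λμ≠0); that direction is proved assuming (z−λ)τ−3σ is a polynomial in z of degree ≤3. The converse is proved without this. Time is complex, dependence on t holomorphic. *)

theory Defs
  imports
    "HOL-Complex_Analysis.Complex_Analysis"
    "HOL-Computational_Algebra.Polynomial"
begin

text \<open>
  A family of functions is a curried function of the time and of the variable z, so \<open>f t\<close> is the
  function of z at time t.
\<close>

definition dot :: "(complex \<Rightarrow> complex \<Rightarrow> complex) \<Rightarrow> complex \<Rightarrow> complex \<Rightarrow> complex" where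
  "dot f t z = deriv (\<lambda>s. f s z) t"

definition holomorphic_poly_family :: "complex set \<Rightarrow> (complex \<Rightarrow> complex poly) \<Rightarrow> bool" where
  "holomorphic_poly_family T P \<longleftrightarrow>
     (\<exists>n. \<forall>t\<in>T. degree (P t) \<le> n) \<and> (\<forall>i. (\<lambda>t. coeff (P t) i) holomorphic_on T)"

text \<open>
  Nothing is assumed about \<open>f t z\<close> at the zeros of the denominator \<open>D t\<close>; such z are never used as
  arguments (see \<open>regular_point\<close>).
\<close>

definition rational_family ::
  "complex set \<Rightarrow> (complex \<Rightarrow> complex poly) \<Rightarrow> (complex \<Rightarrow> complex poly) \<Rightarrow>
   (complex \<Rightarrow> complex \<Rightarrow> complex) \<Rightarrow> bool" where
  "rational_family T N D f \<longleftrightarrow>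
     holomorphic_poly_family T N \<and> holomorphic_poly_family T D \<and>
     (\<forall>t\<in>T. D t \<noteq> 0 \<and> (\<forall>z. poly (D t) z \<noteq> 0 \<longrightarrow> f t z = poly (N t) z / poly (D t) z))"

text \<open>
  Holds at the points z that are neither a pole of \<open>\<sigma>\<close>, \<open>\<tau>\<close>, \<open>\<eta>\<close> (with denominators \<open>Ds\<close>, \<open>Dt\<close>, \<open>De\<close>)
  nor a zero of \<open>\<sigma>\<close>. When \<open>\<sigma> t\<close> is not identically zero these are all but finitely many points, so
  an identity between rational functions of z holds iff it holds at all of them different from the
  parameter \<open>l\<close>.
\<close>

definition regular_point ::
  "(complex \<Rightarrow> complex poly) \<Rightarrow> (complex \<Rightarrow> complex poly) \<Rightarrow> (complex \<Rightarrow> complex poly) \<Rightarrow>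
   (complex \<Rightarrow> complex \<Rightarrow> complex) \<Rightarrow> complex \<Rightarrow> complex \<Rightarrow> bool" where
  "regular_point Ds Dt De \<sigma> t z \<longleftrightarrow>
     poly (Ds t) z \<noteq> 0 \<and> poly (Dt t) z \<noteq> 0 \<and> poly (De t) z \<noteq> 0 \<and> \<sigma> t z \<noteq> 0"

text \<open>
  In the following three conditions \<open>c\<close> is the polynomial in z at fixed \<open>(t, l)\<close>, where \<open>l\<close> is the
  parameter usually written as a lower case lambda.
\<close>

definition condition_tau ::
  "(complex \<Rightarrow> complex \<Rightarrow> complex) \<Rightarrow> (complex \<Rightarrow> complex \<Rightarrow> complex) \<Rightarrow> complex poly \<Rightarrow>
   complex \<Rightarrow> complex \<Rightarrow> complex \<Rightarrow> bool" where
  "condition_tau \<sigma> \<tau> c t l z \<longleftrightarrow>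
     (let f = (\<lambda>x. poly c x * \<tau> t x / \<sigma> t x) in
      0 = dot \<tau> t z / \<sigma> t z - \<tau> t z * dot \<sigma> t z / (\<sigma> t z)\<^sup>2
          + (f z - f l - (z - l) * deriv f z) / (z - l)\<^sup>2)"

definition condition_eta ::
  "(complex \<Rightarrow> complex \<Rightarrow> complex) \<Rightarrow> (complex \<Rightarrow> complex \<Rightarrow> complex) \<Rightarrow> complex poly \<Rightarrow>
   complex \<Rightarrow> complex \<Rightarrow> complex \<Rightarrow> bool" where
  "condition_eta \<sigma> \<eta> c t l z \<longleftrightarrow>
     (let g = (\<lambda>x. poly c x * deriv (\<sigma> t) x / \<sigma> t x);
          h = (\<lambda>x. poly c x * \<eta> t x) in
      0 = - (dot \<sigma> t z / \<sigma> t z) * (\<eta> t z - \<eta> t l) + dot \<eta> t z - dot \<eta> t l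
          + (\<eta> t z - \<eta> t l) / (z - l) * (g z - poly (pderiv c) z)
          - deriv (\<eta> t) l * (g l - poly (pderiv c) l)
          + (2 * h z - 2 * h l - (deriv h z + deriv h l) * (z - l)) / (z - l)\<^sup>2)"

definition condition_sigma ::
  "(complex \<Rightarrow> complex \<Rightarrow> complex) \<Rightarrow> complex poly \<Rightarrow> complex \<Rightarrow> complex \<Rightarrow> complex \<Rightarrow> bool" where
  "condition_sigma \<sigma> c t l z \<longleftrightarrow>
     (let g = (\<lambda>x. poly c x * deriv (\<sigma> t) x / \<sigma> t x) in
      0 = dot \<sigma> t z / \<sigma> t z - dot \<sigma> t l / \<sigma> t l
          - (g z - g l - deriv g l * (z - l)) / (z - l))"

definition compat_a :: "complex poly \<Rightarrow> complex \<Rightarrow> complex \<Rightarrow> complex" where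
  "compat_a c l z = poly c z / (z - l)"

definition compat_b :: "complex poly \<Rightarrow> complex \<Rightarrow> complex \<Rightarrow> complex \<Rightarrow> complex" where
  "compat_b c l \<mu> z = - (poly c l * \<mu> / (z - l))"

definition deformed_p ::
  "(complex \<Rightarrow> complex \<Rightarrow> complex) \<Rightarrow> (complex \<Rightarrow> complex \<Rightarrow> complex) \<Rightarrow>
   complex \<Rightarrow> complex \<Rightarrow> complex \<Rightarrow> complex" where
  "deformed_p \<sigma> \<tau> t l z = \<tau> t z / \<sigma> t z - 1 / (z - l)"

definition deformed_q ::
  "(complex \<Rightarrow> complex \<Rightarrow> complex) \<Rightarrow> (complex \<Rightarrow> complex \<Rightarrow> complex) \<Rightarrow>
   (complex \<Rightarrow> complex \<Rightarrow> complex) \<Rightarrow> complex \<Rightarrow> complex \<Rightarrow> complex \<Rightarrow> complex \<Rightarrow> complex" where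
  "deformed_q \<sigma> \<tau> \<eta> t l \<mu> z =
     1 / \<sigma> t z * (\<eta> t z - \<eta> t l - \<mu> * (\<tau> t l - deriv (\<sigma> t) l) - \<mu>\<^sup>2 * \<sigma> t l + \<mu> * \<sigma> t l / (z - l))"

text \<open>
  The compatibility conditions of \<open>v'' + p v' + q v = 0\<close> and \<open>dv/dt = a v' + b v\<close>, where \<open>p\<close> and \<open>q\<close>
  are families and \<open>a\<close> and \<open>b\<close> are the compatibility functions at the time t.
\<close>

definition compatible_at ::
  "(complex \<Rightarrow> complex \<Rightarrow> complex) \<Rightarrow> (complex \<Rightarrow> complex \<Rightarrow> complex) \<Rightarrow>
   (complex \<Rightarrow> complex) \<Rightarrow> (complex \<Rightarrow> complex) \<Rightarrow> complex \<Rightarrow> complex \<Rightarrow> bool" where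
  "compatible_at p q a b t z \<longleftrightarrow>
     dot p t z - a z * deriv (p t) z + 2 * deriv b z - p t z * deriv a z + (deriv ^^ 2) a z = 0 \<and>
     dot q t z + p t z * deriv b z - 2 * q t z * deriv a z - a z * deriv (q t) z
       + (deriv ^^ 2) b z = 0"

text \<open>\<open>L\<close> and \<open>M\<close> are the time-dependent \<open>l\<close> and \<open>\<mu>\<close>, and \<open>c t l\<close> is a polynomial in z.\<close>

definition lambda_equation ::
  "(complex \<Rightarrow> complex \<Rightarrow> complex) \<Rightarrow> (complex \<Rightarrow> complex \<Rightarrow> complex) \<Rightarrow>
   (complex \<Rightarrow> complex \<Rightarrow> complex poly) \<Rightarrow> (complex \<Rightarrow> complex) \<Rightarrow> (complex \<Rightarrow> complex) \<Rightarrow>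
   complex \<Rightarrow> bool" where
  "lambda_equation \<sigma> \<tau> c L M t \<longleftrightarrow>
     (let l = L t; \<mu> = M t; C = c t l in
      deriv L t = 2 * poly C l * \<mu> - poly (pderiv C) l + poly C l * \<tau> t l / \<sigma> t l)"

definition mu_equation ::
  "(complex \<Rightarrow> complex \<Rightarrow> complex) \<Rightarrow> (complex \<Rightarrow> complex \<Rightarrow> complex) \<Rightarrow>
   (complex \<Rightarrow> complex \<Rightarrow> complex) \<Rightarrow> (complex \<Rightarrow> complex \<Rightarrow> complex poly) \<Rightarrow>
   (complex \<Rightarrow> complex) \<Rightarrow> (complex \<Rightarrow> complex) \<Rightarrow> complex \<Rightarrow> bool" where
  "mu_equation \<sigma> \<tau> \<eta> c L M t \<longleftrightarrow>
     (let l = L t; \<mu> = M t; C = c t l in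
      deriv M t = - (poly C l * deriv (\<eta> t) l / \<sigma> t l)
        - \<mu> * (poly C l * deriv (\<tau> t) l / \<sigma> t l
               - poly C l * (deriv ^^ 2) (\<sigma> t) l / (2 * \<sigma> t l)
               - poly (pderiv (pderiv C)) l / 2)
        - \<mu>\<^sup>2 * (deriv (\<sigma> t) l * poly C l / \<sigma> t l))"

text \<open>
  The third-order pole of \<open>b''\<close> at \<open>z = l\<close> leaves, in the second compatibility condition, the term
  \<open>c(l) \<mu> ((z - l) \<tau>(z) - 3 \<sigma>(z)) / (\<sigma>(z) (z - l)^3)\<close>. It combines with the remaining ones only
  if the numerator is a polynomial in z of degree at most 3. This holds automatically in the Heun
  class, where \<open>\<sigma>\<close> and \<open>\<tau>\<close> are polynomials of degree at most 3 and 2, but not for arbitrary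
  rational functions: if \<open>\<sigma>(z) = z^4\<close>, \<open>\<tau> = \<eta> = 0\<close> and \<open>c(z) = z\<close>, then the three conditions hold,
  but no solution of the differential equations with \<open>l\<close>, \<open>\<mu>\<close> nonzero is compatible.
\<close>

definition heun_type ::
  "(complex \<Rightarrow> complex poly) \<Rightarrow> (complex \<Rightarrow> complex poly) \<Rightarrow> (complex \<Rightarrow> complex poly) \<Rightarrow>
   (complex \<Rightarrow> complex \<Rightarrow> complex) \<Rightarrow> (complex \<Rightarrow> complex \<Rightarrow> complex) \<Rightarrow>
   complex \<Rightarrow> complex \<Rightarrow> bool" where
  "heun_type Ds Dt De \<sigma> \<tau> t l \<longleftrightarrow>
     (\<exists>r. degree r \<le> 3 \<and>
        (\<forall>z. regular_point Ds Dt De \<sigma> t z \<longrightarrow> (z - l) * \<tau> t z - 3 * \<sigma> t z = poly r z))"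

end

theory Submission
  imports Defs
begin

text \<open>
  Fix the time, write \<open>x = z - \<lambda>\<close>, and let an index \<open>0, 1, \<dots>\<close> denote the derivative of that order
  with respect to z, taken at \<open>z = \<lambda>\<close>.

  In the first compatibility condition \<open>a p' + p a'\<close> is the derivative of
  \<open>a p = c \<tau> / (\<sigma> x) - c / x\<^sup>2\<close>, so the condition imposed on \<open>\<tau>\<close> cancels every term that involves
  values of \<open>\<sigma>\<close> and \<open>\<tau>\<close> at \<open>z\<close>. Since \<open>c\<close> is quadratic, the remaining terms have a double pole at
  \<open>\<lambda>\<close> and nothing else: the left-hand side is the residual of the equation for \<open>\<lambda>\<close> divided by \<open>x\<^sup>2\<close>
  (\<open>first_compatibility\<close>).

  Once \<open>\<lambda>\<close> satisfies its equation, the conditions imposed on \<open>\<eta>\<close> and \<open>\<sigma>\<close> remove in the same way the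
  values at \<open>z\<close> from the second compatibility condition, except for the combination
  \<open>r = x \<tau> - 3 \<sigma>\<close>, which comes from \<open>\<sigma> (p b' + b'') = c\<^sub>0 \<mu> r / x\<^sup>3\<close>. The rest is a Laurent
  polynomial in \<open>x\<close>. Its coefficients contain the time derivatives of \<open>\<tau> / \<sigma>\<close> and \<open>\<sigma>' / \<sigma>\<close> at \<open>\<lambda>\<close>;
  the leading terms of the conditions on \<open>\<tau>\<close> and \<open>\<sigma>\<close> as \<open>z\<close> tends to \<open>\<lambda>\<close> express them
  through z-derivatives. The outcome (\<open>second_compatibility\<close>) is that the
  left-hand side times \<open>\<sigma> x\<^sup>3\<close> equals
  \<open>c\<^sub>0 \<mu> (r - R) + x\<^sup>2 W (\<sigma>\<^sub>0 - (\<tau>\<^sub>0 - \<sigma>\<^sub>1 + 2 \<mu> \<sigma>\<^sub>0) x)\<close>,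
  where \<open>W\<close> is the residual of the equation for \<open>\<mu>\<close> and \<open>R\<close> the cubic Taylor polynomial of \<open>r\<close> at \<open>\<lambda>\<close>.

  Both implications can be read off. In the Heun class \<open>r = R\<close>, so \<open>W = 0\<close> makes the expression
  vanish. Conversely \<open>r - R\<close> always has a zero of order at least 4 at \<open>\<lambda>\<close>, so if
  the expression vanishes near \<open>\<lambda>\<close>, then so does its coefficient \<open>W \<sigma>\<^sub>0\<close> of \<open>x\<^sup>2\<close>; and \<open>\<sigma>\<^sub>0 \<noteq> 0\<close>.

  The time derivative of \<open>q\<close> also sees the functions \<open>\<sigma>\<close>, \<open>\<sigma>'\<close>, \<open>\<tau>\<close>, \<open>\<eta>\<close> at the moving point \<open>\<lambda>(t)\<close>.
  It needs a chain rule for families of rational functions and the symmetry of their mixed partial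
  derivatives.
\<close>

section \<open>Local expansions of holomorphic functions\<close>

lemma second_deriv_mult_divide:
  assumes U: "open U" "z \<in> U" and hol: "u holomorphic_on U" "v holomorphic_on U" "w holomorphic_on U"
    and nz: "\<forall>x\<in>U. w x \<noteq> 0"
  shows "deriv (\<lambda>x. u x * v x / w x) z = (deriv u z * v z + u z * deriv v z) / w z - u z * v z * deriv w z / (w z)\<^sup>2"
   and "deriv (deriv (\<lambda>x. u x * v x / w x)) z =
     (deriv (deriv u) z * v z + 2 * deriv u z * deriv v z + u z * deriv (deriv v) z) / w z
     - 2 * (deriv u z * v z + u z * deriv v z) * deriv w z / (w z)\<^sup>2
     - u z * v z * deriv (deriv w) z / (w z)\<^sup>2 + 2 * u z * v z * (deriv w z)\<^sup>2 / (w z)^3"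
proof -
  note D [derivative_intros] = hol[THEN holomorphic_derivI, OF U(1)]
     hol[THEN holomorphic_deriv, OF U(1), THEN holomorphic_derivI, OF U(1)]
  have 1: "deriv (\<lambda>x. u x * v x / w x) x = (deriv u x * v x + u x * deriv v x) / w x - u x * v x * deriv w x / (w x)\<^sup>2"
    if "x \<in> U" for x
    using nz that
    by (intro DERIV_imp_deriv) (auto intro!: derivative_eq_intros simp: divide_simps power2_eq_square)
  then show "deriv (\<lambda>x. u x * v x / w x) z = (deriv u z * v z + u z * deriv v z) / w z - u z * v z * deriv w z / (w z)\<^sup>2"
    using U by blast
  have "deriv (deriv (\<lambda>x. u x * v x / w x)) z = deriv (\<lambda>x. (deriv u x * v x + u x * deriv v x) / w x - u x * v x * deriv w x / (w x)\<^sup>2) z"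
    using U 1 by (intro deriv_cong_ev) (auto simp: eventually_nhds)
  also have "\<dots> = (deriv (deriv u) z * v z + 2 * deriv u z * deriv v z + u z * deriv (deriv v) z) / w z
     - 2 * (deriv u z * v z + u z * deriv v z) * deriv w z / (w z)\<^sup>2
     - u z * v z * deriv (deriv w) z / (w z)\<^sup>2 + 2 * u z * v z * (deriv w z)\<^sup>2 / (w z)^3"
  proof (rule DERIV_imp_deriv)
    note u = D(1)[OF U(2)] and v = D(2)[OF U(2)] and w = D(3)[OF U(2)]
    note u' = D(4)[OF U(2)] and v' = D(5)[OF U(2)] and w' = D(6)[OF U(2)]
    have wz: "w z \<noteq> 0" "(w z)\<^sup>2 \<noteq> 0" using nz U(2) by auto
    note * = DERIV_diff[OF DERIV_divide[OF DERIV_add[OF DERIV_mult[OF u' v] DERIV_mult[OF u v']] w wz(1)]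
      DERIV_divide[OF DERIV_mult[OF DERIV_mult[OF u v] w'] DERIV_power[OF w, of 2] wz(2)]]
    show "((\<lambda>x. (deriv u x * v x + u x * deriv v x) / w x - u x * v x * deriv w x / (w x)\<^sup>2) has_field_derivative
       (deriv (deriv u) z * v z + 2 * deriv u z * deriv v z + u z * deriv (deriv v) z) / w z
       - 2 * (deriv u z * v z + u z * deriv v z) * deriv w z / (w z)\<^sup>2
       - u z * v z * deriv (deriv w) z / (w z)\<^sup>2 + 2 * u z * v z * (deriv w z)\<^sup>2 / (w z)^3) (at z)"
      by (rule DERIV_cong[OF *]) (use wz in \<open>simp add: field_simps power2_eq_square power3_eq_cube\<close>)
  qed
  finally show "deriv (deriv (\<lambda>x. u x * v x / w x)) z = \<dots>" .
qed

lemma deriv_eq_0_on_open: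
  assumes "open U" "z \<in> U" "\<And>x. x \<in> U \<Longrightarrow> f x = 0"
  shows "deriv f z = (0::complex)"
  using deriv_cong_ev[of f "\<lambda>_. 0" z z] assms by (auto simp: eventually_nhds)

text \<open>
  The quotient tends to \<open>- f''(l) / 2\<close> as \<open>z\<close> tends to \<open>l\<close>. Instead of taking the limit, the
  hypothesis is multiplied by \<open>(z - l)\<^sup>2\<close> and differentiated twice at \<open>l\<close>. This lemma and the next one
  extract from the conditions on \<open>\<tau>\<close> and \<open>\<sigma>\<close> what they say at the point \<open>\<lambda>\<close> itself.
\<close>

lemma second_order_limit:
  assumes U: "open U" "l \<in> U" and hol: "A holomorphic_on U" "f holomorphic_on U"
    and eq: "\<And>z. z \<in> U \<Longrightarrow> z \<noteq> l \<Longrightarrow> A z + (f z - f l - (z - l) * deriv f z) / (z - l)\<^sup>2 = 0"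
  shows "A l = deriv (deriv f) l / 2"
proof -
  note D [derivative_intros] = hol[THEN holomorphic_derivI, OF U(1)]
     hol[THEN holomorphic_deriv, OF U(1), THEN holomorphic_derivI, OF U(1)]
  define G where "G z = (z - l)\<^sup>2 * A z + f z - f l - (z - l) * deriv f z" for z
  have G0: "G z = 0" if "z \<in> U" for z
    using eq[OF that] by (cases "z = l") (auto simp: G_def field_simps)
  have G1: "deriv G z = 2 * (z - l) * A z + (z - l)\<^sup>2 * deriv A z - (z - l) * deriv (deriv f) z"
    if "z \<in> U" for z
    unfolding G_def using that
    by (intro DERIV_imp_deriv) (auto intro!: derivative_eq_intros simp: algebra_simps)
  have "deriv (\<lambda>z. 2 * (z - l) * A z + (z - l)\<^sup>2 * deriv A z - (z - l) * deriv (deriv f) z) l = 0"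
    using U G0 G1 by (intro deriv_eq_0_on_open[OF U]) (metis deriv_eq_0_on_open)
  moreover have "deriv (\<lambda>z. 2 * (z - l) * A z + (z - l)\<^sup>2 * deriv A z - (z - l) * deriv (deriv f) z) l
     = 2 * A l - deriv (deriv f) l"
    using U(2) hol(2)[THEN holomorphic_deriv, OF U(1), THEN holomorphic_deriv, OF U(1), THEN holomorphic_derivI, OF U(1,2)]
    by (intro DERIV_imp_deriv) (auto intro!: derivative_eq_intros)
  ultimately show ?thesis by (simp add: field_simps)
qed

text \<open>
  The two terms of the hypothesis tend to 0 at \<open>l\<close>; this compares their first-order coefficients.
\<close>

lemma first_order_limit:
  assumes U: "open U" "l \<in> U" and hol: "S holomorphic_on U" "g holomorphic_on U"
    and eq: "\<And>z. z \<in> U \<Longrightarrow> z \<noteq> l \<Longrightarrow> S z - S l - (g z - g l - deriv g l * (z - l)) / (z - l) = 0"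
  shows "deriv S l = deriv (deriv g) l / 2"
proof -
  note D [derivative_intros] = hol[THEN holomorphic_derivI, OF U(1)]
     hol[THEN holomorphic_deriv, OF U(1), THEN holomorphic_derivI, OF U(1)]
  define G where "G z = (z - l) * (S z - S l) - (g z - g l - deriv g l * (z - l))" for z
  have G0: "G z = 0" if "z \<in> U" for z
    using eq[OF that] by (cases "z = l") (auto simp: G_def field_simps)
  have G1: "deriv G z = S z - S l + (z - l) * deriv S z - deriv g z + deriv g l" if "z \<in> U" for z
    unfolding G_def using that
    by (intro DERIV_imp_deriv) (auto intro!: derivative_eq_intros simp: algebra_simps)
  have "deriv (\<lambda>z. S z - S l + (z - l) * deriv S z - deriv g z + deriv g l) l = 0"
    using U G0 G1 by (intro deriv_eq_0_on_open[OF U]) (metis deriv_eq_0_on_open)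
  moreover have "deriv (\<lambda>z. S z - S l + (z - l) * deriv S z - deriv g z + deriv g l) l
     = 2 * deriv S l - deriv (deriv g) l"
    using U(2) by (intro DERIV_imp_deriv) (auto intro!: derivative_eq_intros)
  ultimately show ?thesis by (simp add: field_simps)
qed

lemma poly_quadratic_at:
  fixes C :: "complex poly"
  assumes "degree C \<le> 2"
  shows "poly C z = poly C l + poly (pderiv C) l * (z - l) + poly (pderiv (pderiv C)) l / 2 * (z - l)\<^sup>2"
    and "poly (pderiv C) z = poly (pderiv C) l + poly (pderiv (pderiv C)) l * (z - l)"
    and "poly (pderiv (pderiv C)) z = poly (pderiv (pderiv C)) l"
proof -
  obtain a b d where C: "C = [:a, b, d:]"
  proof
    show "C = [:coeff C 0, coeff C 1, coeff C 2:]"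
      using assms by (auto simp: poly_eq_iff coeff_pCons coeff_eq_0 numeral_2_eq_2 split: nat.splits)
  qed
  show "poly C z = poly C l + poly (pderiv C) l * (z - l) + poly (pderiv (pderiv C)) l / 2 * (z - l)\<^sup>2"
    "poly (pderiv C) z = poly (pderiv C) l + poly (pderiv (pderiv C)) l * (z - l)"
    "poly (pderiv (pderiv C)) z = poly (pderiv (pderiv C)) l"
    by (simp_all add: C pderiv_pCons algebra_simps power2_eq_square)
qed

lemma poly_cubic_at:
  fixes C :: "complex poly"
  assumes "degree C \<le> 3"
  shows "poly C z = poly C l + poly (pderiv C) l * (z - l) + poly (pderiv (pderiv C)) l / 2 * (z - l)\<^sup>2
    + poly (pderiv (pderiv (pderiv C))) l / 6 * (z - l)^3"
proof -
  obtain a b d e where C: "C = [:a, b, d, e:]"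
  proof
    show "C = [:coeff C 0, coeff C 1, coeff C 2, coeff C 3:]"
      using assms by (auto simp: poly_eq_iff coeff_pCons coeff_eq_0 numeral_3_eq_3 numeral_2_eq_2 split: nat.splits)
  qed
  show ?thesis
    by (simp add: C pderiv_pCons field_simps power2_eq_square power3_eq_cube)
qed

definition cubic_remainder :: "(complex \<Rightarrow> complex) \<Rightarrow> complex \<Rightarrow> complex \<Rightarrow> complex" where
  "cubic_remainder f l z = f z - (f l + deriv f l * (z - l) + deriv (deriv f) l / 2 * (z - l)\<^sup>2
     + deriv (deriv (deriv f)) l / 6 * (z - l)^3)"

lemma cubic_remainder_poly:
  assumes U: "open U" "l \<in> U" "z \<in> U" and f: "\<And>x. x \<in> U \<Longrightarrow> f x = poly r x" and r: "degree r \<le> 3"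
  shows "cubic_remainder f l z = 0"
proof -
  have step: "\<forall>x\<in>U. deriv g x = poly (pderiv p) x" if "\<forall>x\<in>U. g x = poly p x" for g p
  proof
    fix x assume "x \<in> U"
    then have "deriv g x = deriv (poly p) x"
      using that U by (intro deriv_cong_ev) (auto simp: eventually_nhds)
    then show "deriv g x = poly (pderiv p) x"
      by (simp add: DERIV_imp_deriv[OF poly_DERIV])
  qed
  have 0: "\<forall>x\<in>U. f x = poly r x" using f by blast
  note 1 = step[OF 0] note 2 = step[OF 1] note 3 = step[OF 2]
  show ?thesis
    unfolding cubic_remainder_def using 0 1 2 3 U poly_cubic_at[OF r, of z l] by simp
qed

text \<open>
  The remainder vanishes to fourth order at \<open>l\<close>, so the second derivative at \<open>l\<close> of the left-hand side
  is \<open>2 A\<close>. With \<open>A\<close> the residual of the equation for \<open>\<mu>\<close> times \<open>\<sigma>(\<lambda>)\<close>, this is how compatibility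
  forces that equation.
\<close>

lemma quadratic_coefficient_eq_0:
  assumes U: "open U" "l \<in> U" and f: "f holomorphic_on U"
    and eq: "\<And>z. z \<in> U \<Longrightarrow> z \<noteq> l \<Longrightarrow> k * cubic_remainder f l z + (z - l)\<^sup>2 * (A - B * (z - l)) = 0"
  shows "A = 0"
proof -
  note d = f[THEN holomorphic_derivI, OF U(1)]
     f[THEN holomorphic_deriv, OF U(1), THEN holomorphic_derivI, OF U(1)]
  define G where "G z = k * cubic_remainder f l z + (z - l)\<^sup>2 * (A - B * (z - l))" for z
  have G0: "G z = 0" if "z \<in> U" for z
    using eq[OF that] by (cases "z = l") (auto simp: G_def cubic_remainder_def)
  have G1: "deriv G z = k * (deriv f z - deriv f l - deriv (deriv f) l * (z - l)
      - deriv (deriv (deriv f)) l / 2 * (z - l)\<^sup>2) + 2 * (z - l) * A - 3 * B * (z - l)\<^sup>2"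
    if "z \<in> U" for z
    unfolding G_def cubic_remainder_def using that
    by (intro DERIV_imp_deriv)
       (auto intro!: derivative_eq_intros d simp: field_simps power2_eq_square)
  have "deriv (\<lambda>z. k * (deriv f z - deriv f l - deriv (deriv f) l * (z - l)
      - deriv (deriv (deriv f)) l / 2 * (z - l)\<^sup>2) + 2 * (z - l) * A - 3 * B * (z - l)\<^sup>2) l = 0"
    using U G0 G1 by (intro deriv_eq_0_on_open[OF U]) (metis deriv_eq_0_on_open)
  moreover have "deriv (\<lambda>z. k * (deriv f z - deriv f l - deriv (deriv f) l * (z - l)
      - deriv (deriv (deriv f)) l / 2 * (z - l)\<^sup>2) + 2 * (z - l) * A - 3 * B * (z - l)\<^sup>2) l = 2 * A"
    using U(2) by (intro DERIV_imp_deriv) (auto intro!: derivative_eq_intros d)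
  ultimately show ?thesis by simp
qed

section \<open>Families of rational functions\<close>

text \<open>
  The polynomial of the time derivatives of the coefficients. On the time domain of a holomorphic
  family the degree bound of the family makes these coefficients finitely supported
  (\<open>coeff_dot_poly\<close>).
\<close>

definition dot_poly :: "(complex \<Rightarrow> complex poly) \<Rightarrow> complex \<Rightarrow> complex poly" where
  "dot_poly P t = Abs_poly (\<lambda>i. deriv (\<lambda>s. coeff (P s) i) t)"

lemma coeff_dot_poly:
  assumes "holomorphic_poly_family T P" "open T" "t \<in> T"
  shows "coeff (dot_poly P t) i = deriv (\<lambda>s. coeff (P s) i) t"
proof -
  obtain n where n: "\<And>t. t \<in> T \<Longrightarrow> degree (P t) \<le> n"
    using assms by (auto simp: holomorphic_poly_family_def)
  have "deriv (\<lambda>s. coeff (P s) i) t = 0" if "i > n" for i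
    using assms that by (intro deriv_eq_0_on_open[of T]) (auto intro: coeff_eq_0 le_less_trans[OF n])
  then have "\<forall>\<^sub>\<infinity>i. deriv (\<lambda>s. coeff (P s) i) t = 0"
    by (auto simp: MOST_nat)
  then show ?thesis
    by (simp add: dot_poly_def Abs_poly_inverse)
qed

lemma poly_eq_sum_upto:
  fixes p :: "complex poly"
  assumes "degree p \<le> n"
  shows "poly p x = (\<Sum>i\<le>n. coeff p i * x ^ i)"
  unfolding poly_altdef using assms
  by (intro sum.mono_neutral_left) (auto simp: coeff_eq_0)

lemma poly_pderiv_eq_sum_upto:
  fixes p :: "complex poly"
  assumes "degree p \<le> n"
  shows "poly (pderiv p) x = (\<Sum>i\<le>n. coeff p i * (of_nat i * x ^ (i - 1)))"
proof -
  have "((\<lambda>x. \<Sum>i\<le>n. coeff p i * x ^ i) has_field_derivative (\<Sum>i\<le>n. coeff p i * (of_nat i * x ^ (i - 1)))) (at x)"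
    by (auto intro!: derivative_eq_intros sum.cong)
  then show ?thesis
    unfolding poly_eq_sum_upto[OF assms, symmetric] using poly_DERIV DERIV_unique by blast
qed

lemma degree_dot_poly:
  assumes "holomorphic_poly_family T P" "open T"
  obtains n where "\<And>t. t \<in> T \<Longrightarrow> degree (P t) \<le> n" "\<And>t. t \<in> T \<Longrightarrow> degree (dot_poly P t) \<le> n"
proof -
  obtain n where n: "\<And>t. t \<in> T \<Longrightarrow> degree (P t) \<le> n"
    using assms by (auto simp: holomorphic_poly_family_def)
  have "degree (dot_poly P t) \<le> n" if "t \<in> T" for t
  proof (rule degree_le, intro allI impI)
    fix i assume "i > n"
    then show "coeff (dot_poly P t) i = 0"
      unfolding coeff_dot_poly[OF assms that]
      using assms that by (intro deriv_eq_0_on_open[of T]) (auto intro: coeff_eq_0 le_less_trans[OF n])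
  qed
  with n that show thesis by blast
qed

text \<open>
  The total derivative along a moving point: the family is a sum, of length independent of the time,
  of products \<open>coeff (P s) i * \<zeta> s ^ i\<close>.
\<close>

lemma poly_family_chain_rule:
  assumes P: "holomorphic_poly_family T P" and T: "open T" "t \<in> T"
    and \<zeta>: "(\<zeta> has_field_derivative \<zeta>') (at t)"
  shows "((\<lambda>s. poly (P s) (\<zeta> s)) has_field_derivative
     poly (dot_poly P t) (\<zeta> t) + poly (pderiv (P t)) (\<zeta> t) * \<zeta>') (at t)"
proof -
  obtain n where n: "\<And>t. t \<in> T \<Longrightarrow> degree (P t) \<le> n" "\<And>t. t \<in> T \<Longrightarrow> degree (dot_poly P t) \<le> n"
    using degree_dot_poly[OF P T(1)] by blast
  have coeff: "((\<lambda>s. coeff (P s) i) has_field_derivative coeff (dot_poly P t) i) (at t)" for i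
    unfolding coeff_dot_poly[OF P T] using P T
    by (auto simp: holomorphic_poly_family_def intro: holomorphic_derivI)
  have "((\<lambda>s. \<Sum>i\<le>n. coeff (P s) i * \<zeta> s ^ i) has_field_derivative
     (\<Sum>i\<le>n. coeff (dot_poly P t) i * \<zeta> t ^ i + coeff (P t) i * (of_nat i * \<zeta> t ^ (i - 1)) * \<zeta>')) (at t)"
    by (rule derivative_eq_intros coeff \<zeta> refl)+ (simp add: algebra_simps)
  also have "(\<Sum>i\<le>n. coeff (dot_poly P t) i * \<zeta> t ^ i + coeff (P t) i * (of_nat i * \<zeta> t ^ (i - 1)) * \<zeta>')
     = poly (dot_poly P t) (\<zeta> t) + poly (pderiv (P t)) (\<zeta> t) * \<zeta>'"
    using n T by (simp add: poly_eq_sum_upto[of _ n] poly_pderiv_eq_sum_upto[of _ n] sum.distrib sum_distrib_right)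
  finally show ?thesis
    by (rule DERIV_cong_ev[THEN iffD1, rotated -1])
       (use T n in \<open>auto simp: eventually_nhds intro!: exI[of _ T] poly_eq_sum_upto[symmetric]\<close>)
qed

lemma holomorphic_poly_family_mult:
  assumes "holomorphic_poly_family T P" "holomorphic_poly_family T Q"
  shows "holomorphic_poly_family T (\<lambda>t. P t * Q t)"
proof -
  obtain n m where "\<forall>t\<in>T. degree (P t) \<le> n" "\<forall>t\<in>T. degree (Q t) \<le> m"
    using assms by (auto simp: holomorphic_poly_family_def)
  then have "\<forall>t\<in>T. degree (P t * Q t) \<le> n + m"
    by (meson add_mono degree_mult_le order_trans)
  with assms show ?thesis
    by (auto simp: holomorphic_poly_family_def coeff_mult intro!: holomorphic_intros)
qed

lemma holomorphic_poly_family_diff: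
  assumes "holomorphic_poly_family T P" "holomorphic_poly_family T Q"
  shows "holomorphic_poly_family T (\<lambda>t. P t - Q t)"
proof -
  obtain n m where "\<forall>t\<in>T. degree (P t) \<le> n" "\<forall>t\<in>T. degree (Q t) \<le> m"
    using assms by (auto simp: holomorphic_poly_family_def)
  then have "\<forall>t\<in>T. degree (P t - Q t) \<le> max n m"
    by (meson degree_diff_le_max max.mono order_trans)
  with assms show ?thesis
    by (auto simp: holomorphic_poly_family_def intro!: holomorphic_intros)
qed

lemma holomorphic_poly_family_pderiv:
  assumes "holomorphic_poly_family T P"
  shows "holomorphic_poly_family T (\<lambda>t. pderiv (P t))"
proof -
  obtain n where "\<And>t. t \<in> T \<Longrightarrow> degree (P t) \<le> n"
    using assms by (auto simp: holomorphic_poly_family_def)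
  then have "\<forall>t\<in>T. degree (pderiv (P t)) \<le> n"
    by (auto simp: degree_pderiv intro: diff_le_self order_trans)
  with assms show ?thesis
    by (auto simp: holomorphic_poly_family_def coeff_pderiv intro!: holomorphic_intros)
qed

lemma holomorphic_poly_family_dot_poly:
  assumes "holomorphic_poly_family T P" "open T"
  shows "holomorphic_poly_family T (dot_poly P)"
proof -
  have "(\<lambda>t. coeff (dot_poly P t) i) holomorphic_on T" for i
    using holomorphic_deriv[of "\<lambda>t. coeff (P t) i" T] assms
    by (subst holomorphic_cong[OF refl coeff_dot_poly[OF assms]])
       (auto simp: holomorphic_poly_family_def)
  with degree_dot_poly[OF assms] show ?thesis
    unfolding holomorphic_poly_family_def by metis
qed

text \<open>
  Time and space derivatives of a polynomial family commute because \<open>pderiv\<close> only rescales and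
  shifts coefficients. The symmetry of mixed partials of rational families reduces to this.
\<close>

lemma dot_poly_pderiv:
  assumes "holomorphic_poly_family T P" "open T" "t \<in> T"
  shows "dot_poly (\<lambda>s. pderiv (P s)) t = pderiv (dot_poly P t)"
proof (rule poly_eqI)
  fix i
  show "coeff (dot_poly (\<lambda>s. pderiv (P s)) t) i = coeff (pderiv (dot_poly P t)) i"
    using assms holomorphic_on_imp_differentiable_at[of "\<lambda>s. coeff (P s) (Suc i)" T t]
    by (simp add: coeff_dot_poly[OF holomorphic_poly_family_pderiv[OF assms(1)] assms(2,3)]
        coeff_dot_poly[OF assms] coeff_pderiv holomorphic_poly_family_def)
qed

text \<open>
  Both partial derivatives appear here as explicit quotients over \<open>D\<^sup>2\<close>. They show that the
  families \<open>dot f\<close> and \<open>deriv (f t)\<close> are rational again, so that the chain rule also applies to \<open>\<sigma>'\<close>.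
\<close>

lemma rational_family_chain_rule_quotient:
  assumes f: "rational_family T N D f" and T: "open T" "t \<in> T" and nz: "poly (D t) (\<zeta> t) \<noteq> 0"
    and \<zeta>: "(\<zeta> has_field_derivative \<zeta>') (at t)"
  shows "((\<lambda>s. f s (\<zeta> s)) has_field_derivative
      poly (dot_poly N t * D t - N t * dot_poly D t) (\<zeta> t) / poly ((D t)\<^sup>2) (\<zeta> t)
      + poly (pderiv (N t) * D t - N t * pderiv (D t)) (\<zeta> t) / poly ((D t)\<^sup>2) (\<zeta> t) * \<zeta>') (at t)"
proof -
  from f have N: "holomorphic_poly_family T N" and D: "holomorphic_poly_family T D"
    by (auto simp: rational_family_def)
  note dN = poly_family_chain_rule[OF N T \<zeta>] and dD = poly_family_chain_rule[OF D T \<zeta>]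
  have "((\<lambda>s. poly (D s) (\<zeta> s)) \<longlongrightarrow> poly (D t) (\<zeta> t)) (nhds t)"
    using DERIV_isCont[OF dD]
    by (simp add: isCont_def tendsto_at_iff_tendsto_nhds[of "\<lambda>s. poly (D s) (\<zeta> s)"])
  then have "eventually (\<lambda>s. poly (D s) (\<zeta> s) \<noteq> 0) (nhds t)"
    using nz by (rule tendsto_imp_eventually_ne)
  moreover have "eventually (\<lambda>s. s \<in> T) (nhds t)"
    using T eventually_nhds by blast
  ultimately have ev: "eventually (\<lambda>s. poly (N s) (\<zeta> s) / poly (D s) (\<zeta> s) = f s (\<zeta> s)) (nhds t)"
    by eventually_elim (use f in \<open>auto simp: rational_family_def\<close>)
  have "((\<lambda>s. poly (N s) (\<zeta> s) / poly (D s) (\<zeta> s)) has_field_derivative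
      poly (dot_poly N t * D t - N t * dot_poly D t) (\<zeta> t) / poly ((D t)\<^sup>2) (\<zeta> t)
      + poly (pderiv (N t) * D t - N t * pderiv (D t)) (\<zeta> t) / poly ((D t)\<^sup>2) (\<zeta> t) * \<zeta>') (at t)"
    by (rule DERIV_cong[OF DERIV_divide[OF dN dD nz]])
       (use nz in \<open>simp add: field_simps power2_eq_square\<close>)
  then show ?thesis
    by (rule DERIV_cong_ev[OF refl ev refl, THEN iffD1])
qed

lemma rational_family_dot_eq:
  assumes "rational_family T N D f" "open T" "t \<in> T" "poly (D t) z \<noteq> 0"
  shows "dot f t z = poly (dot_poly N t * D t - N t * dot_poly D t) z / poly ((D t)\<^sup>2) z"
  unfolding dot_def
  by (rule DERIV_imp_deriv)
     (use rational_family_chain_rule_quotient[OF assms(1-3), of "\<lambda>_. z" 0] assms(4) in simp)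

lemma rational_family_deriv_at:
  assumes f: "rational_family T N D f" and t: "t \<in> T" and nz: "poly (D t) z \<noteq> 0"
  shows "(f t has_field_derivative poly (pderiv (N t) * D t - N t * pderiv (D t)) z / poly ((D t)\<^sup>2) z) (at z)"
proof -
  have "open {x. poly (D t) x \<noteq> 0}"
    by (intro open_Collect_neq continuous_intros)
  then have "eventually (\<lambda>x. poly (D t) x \<noteq> 0) (nhds z)"
    using nz by (auto simp: eventually_nhds)
  then have ev: "eventually (\<lambda>x. poly (N t) x / poly (D t) x = f t x) (nhds z)"
    by eventually_elim (use f t in \<open>auto simp: rational_family_def\<close>)
  have "((\<lambda>x. poly (N t) x / poly (D t) x) has_field_derivative 
      poly (pderiv (N t) * D t - N t * pderiv (D t)) z / poly ((D t)\<^sup>2) z) (at z)"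
    by (rule DERIV_cong[OF DERIV_divide[OF poly_DERIV poly_DERIV nz]])
       (use nz in \<open>simp add: field_simps power2_eq_square\<close>)
  then show ?thesis
    by (rule DERIV_cong_ev[OF refl ev refl, THEN iffD1])
qed

lemmas rational_family_deriv_eq = rational_family_deriv_at[THEN DERIV_imp_deriv]

lemma rational_family_holomorphic:
  assumes "rational_family T N D f" "t \<in> T"
  shows "f t holomorphic_on {z. poly (D t) z \<noteq> 0}"
  using rational_family_deriv_at[OF assms]
  by (subst holomorphic_on_open) (auto intro!: open_Collect_neq continuous_intros)

lemma rational_family_dot:
  assumes "rational_family T N D f" "open T"
  shows "rational_family T (\<lambda>t. dot_poly N t * D t - N t * dot_poly D t) (\<lambda>t. (D t)\<^sup>2) (dot f)"
  using assms rational_family_dot_eq[OF assms]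
  by (auto simp: rational_family_def power2_eq_square
      intro!: holomorphic_poly_family_mult holomorphic_poly_family_diff holomorphic_poly_family_dot_poly)

lemma rational_family_deriv:
  assumes "rational_family T N D f"
  shows "rational_family T (\<lambda>t. pderiv (N t) * D t - N t * pderiv (D t)) (\<lambda>t. (D t)\<^sup>2) (\<lambda>t. deriv (f t))"
  using assms rational_family_deriv_eq[OF assms]
  by (auto simp: rational_family_def power2_eq_square
      intro!: holomorphic_poly_family_mult holomorphic_poly_family_diff holomorphic_poly_family_pderiv)

lemma rational_family_chain_rule:
  assumes "rational_family T N D f" "open T" "t \<in> T" "poly (D t) (\<zeta> t) \<noteq> 0"
    and "(\<zeta> has_field_derivative \<zeta>') (at t)"
  shows "((\<lambda>s. f s (\<zeta> s)) has_field_derivative dot f t (\<zeta> t) + deriv (f t) (\<zeta> t) * \<zeta>') (at t)"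
  using rational_family_chain_rule_quotient[OF assms]
  unfolding rational_family_dot_eq[OF assms(1-4)] rational_family_deriv_eq[OF assms(1,3,4)] .

lemma rational_family_mixed_partials:
  assumes f: "rational_family T N D f" and T: "open T" "t \<in> T" and nz: "poly (D t) z \<noteq> 0"
  shows "dot (\<lambda>s. deriv (f s)) t z = deriv (dot f t) z"
proof -
  from f have N: "holomorphic_poly_family T N" and D: "holomorphic_poly_family T D"
    by (auto simp: rational_family_def)
  have d: "((\<lambda>s. poly (P s) z) has_field_derivative poly (dot_poly P t) z) (at t)"
    if "holomorphic_poly_family T P" for P
    using poly_family_chain_rule[OF that T, of "\<lambda>_. z" 0] by simp
  have eq: "poly (dot_poly (\<lambda>t. pderiv (N t) * D t - N t * pderiv (D t)) t) z =
     poly (pderiv (dot_poly N t)) z * poly (D t) z + poly (pderiv (N t)) z * poly (dot_poly D t) z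
     - poly (dot_poly N t) z * poly (pderiv (D t)) z - poly (N t) z * poly (pderiv (dot_poly D t)) z"
    "poly (dot_poly (\<lambda>t. (D t)\<^sup>2) t) z = 2 * poly (D t) z * poly (dot_poly D t) z"
  proof -
    note dN = d[OF N] and dD = d[OF D]
      and dN' = d[OF holomorphic_poly_family_pderiv[OF N], unfolded dot_poly_pderiv[OF N T]]
      and dD' = d[OF holomorphic_poly_family_pderiv[OF D], unfolded dot_poly_pderiv[OF D T]]
    have "((\<lambda>s. poly (pderiv (N s) * D s - N s * pderiv (D s)) z) has_field_derivative 
     poly (pderiv (dot_poly N t)) z * poly (D t) z + poly (pderiv (N t)) z * poly (dot_poly D t) z
     - poly (dot_poly N t) z * poly (pderiv (D t)) z - poly (N t) z * poly (pderiv (dot_poly D t)) z) (at t)"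
      unfolding poly_diff poly_mult
      by (rule derivative_eq_intros dN dD dN' dD' refl)+ (simp add: algebra_simps)
    moreover have "((\<lambda>s. poly (pderiv (N s) * D s - N s * pderiv (D s)) z) has_field_derivative 
       poly (dot_poly (\<lambda>t. pderiv (N t) * D t - N t * pderiv (D t)) t) z) (at t)"
      by (rule d[OF holomorphic_poly_family_diff[OF
            holomorphic_poly_family_mult[OF holomorphic_poly_family_pderiv[OF N] D]
            holomorphic_poly_family_mult[OF N holomorphic_poly_family_pderiv[OF D]]]])
    ultimately show "poly (dot_poly (\<lambda>t. pderiv (N t) * D t - N t * pderiv (D t)) t) z =
     poly (pderiv (dot_poly N t)) z * poly (D t) z + poly (pderiv (N t)) z * poly (dot_poly D t) z
     - poly (dot_poly N t) z * poly (pderiv (D t)) z - poly (N t) z * poly (pderiv (dot_poly D t)) z"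
      by (rule DERIV_unique[rotated])
    have "((\<lambda>s. poly ((D s)\<^sup>2) z) has_field_derivative 2 * poly (D t) z * poly (dot_poly D t) z) (at t)"
      unfolding power2_eq_square poly_mult by (rule derivative_eq_intros dD refl)+ (simp add: algebra_simps)
    moreover have "((\<lambda>s. poly ((D s)\<^sup>2) z) has_field_derivative poly (dot_poly (\<lambda>t. (D t)\<^sup>2) t) z) (at t)"
      unfolding power2_eq_square by (rule d[OF holomorphic_poly_family_mult[OF D D]])
    ultimately show "poly (dot_poly (\<lambda>t. (D t)\<^sup>2) t) z = 2 * poly (D t) z * poly (dot_poly D t) z"
      by (rule DERIV_unique[rotated])
  qed
  have nz2: "poly ((D t)\<^sup>2) z \<noteq> 0" using nz by simp
  show ?thesis
    unfolding rational_family_dot_eq[OF rational_family_deriv[OF f] T nz2]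
      rational_family_deriv_eq[OF rational_family_dot[OF f T(1)] T(2) nz2] poly_diff poly_mult eq
    using nz by (simp add: pderiv_mult pderiv_diff power2_eq_square field_simps)
qed

section \<open>The algebra of the second compatibility condition\<close>

text \<open>
  All analysis is stripped off here. The letters \<open>s, t, e, m\<close> stand for \<open>\<sigma>, \<tau>, \<eta>, \<mu>\<close>; a suffix \<open>d\<close> is a
  time derivative and a numeral the order of a z-derivative at \<open>\<lambda>\<close>. The letters
  \<open>s, t, e, c\<close> and \<open>sd, ed\<close> without numeral are values at \<open>z\<close>, and \<open>ld\<close>, \<open>md\<close> are the time derivatives
  of \<open>\<lambda>\<close> and \<open>\<mu>\<close>. The numbers \<open>g0\<close>, \<open>g1\<close> and \<open>g2\<close> are the derivatives of \<open>c \<sigma>' / \<sigma>\<close> at \<open>\<lambda>\<close>, and \<open>f2\<close> is the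
  second derivative of \<open>c \<tau> / \<sigma>\<close> there.
  
  The proof separates in \<open>Q\<close> the part \<open>e - e0\<close> from the part \<open>R\<close>, whose dependence on \<open>z\<close> is only
  through \<open>x\<close>. The condition on \<open>\<eta>\<close> reduces the former to its pole and a constant; for the latter the condition on \<open>\<sigma>\<close> turns
  the factor \<open>k\<close> of \<open>Q\<close> into a Laurent polynomial in \<open>x\<close>.
\<close>

lemma second_compatibility_algebra:
  fixes x :: complex
  assumes x: "x \<noteq> 0" and s0: "s0 \<noteq> 0" and s: "s \<noteq> 0"
    and c: "c = c0 + c1 * x + c2 / 2 * x^2" and c': "c' = c1 + c2 * x"
    and g0: "g0 = c0 * s1 / s0" and g1: "g1 = (c1 * s1 + c0 * s2) / s0 - c0 * s1^2 / s0^2"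
    and cond3: "sd / s = sd0 / s0 + (c * s' / s - g0 - g1 * x) / x"
    and cond2: "0 = - (sd / s) * (e - e0) + ed - ed0 + (e - e0) / x * (c * s' / s - c') - e1 * (g0 - c1)
          + (2 * (c * e) - 2 * (c0 * e0) - ((c' * e + c * e') + (c1 * e0 + c0 * e1)) * x) / x^2"
    and td: "td0 / s0 - t0 * sd0 / s0^2 = f2 / 2"
    and sd1: "sd1 / s0 - sd0 * s1 / s0^2 = g2 / 2"
    and f2: "f2 = (c2 * t0 + 2 * c1 * t1 + c0 * t2) / s0 - 2 * (c1 * t0 + c0 * t1) * s1 / s0^2 - c0 * t0 * s2 / s0^2 + 2 * c0 * t0 * s1^2 / s0^3"
    and g2: "g2 = (c2 * s1 + 2 * c1 * s2 + c0 * s3) / s0 - 2 * (c1 * s1 + c0 * s2) * s1 / s0^2 - c0 * s1 * s2 / s0^2 + 2 * c0 * s1 * s1^2 / s0^3"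
    and ld: "ld = 2 * c0 * m - c1 + c0 * t0 / s0"
    and r: "r = x * t - 3 * s"
    and W: "W = md + c0 * e1 / s0 + m * (c0 * t1 / s0 - c0 * s2 / (2 * s0) - c2 / 2) + m^2 * (s1 * c0 / s0)"
    and Q: "Q = e - e0 - m * (t0 - s1) - m^2 * s0 + m * s0 / x"
    and Qd: "Qd = ed - (ed0 + e1 * ld) - (md * (t0 - s1) + m * (td0 + t1 * ld - (sd1 + s2 * ld))) 
            - (2 * m * md * s0 + m^2 * (sd0 + s1 * ld)) + (md * s0 + m * (sd0 + s1 * ld)) / x + m * s0 * ld / x^2"
    and Q': "Q' = e' - m * s0 / x^2"
    and LHS: "LHS = (Qd / s - sd * Q / s^2) + (t / s - 1 / x) * (c0 * m / x^2) - 2 * (Q / s) * (c' / x - c / x^2)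
       - c / x * (Q' / s - s' * Q / s^2) - 2 * c0 * m / x^3"
  shows "s * LHS * x^3 = c0 * m * (r - (- 3 * s0 + (t0 - 3 * s1) * x + (t1 - 3 / 2 * s2) * x^2 + (t2 / 2 - s3 / 2) * x^3))
      + x^2 * W * (s0 - (t0 - s1 + 2 * m * s0) * x)"
proof -
  define R where "R = - m * (t0 - s1) - m^2 * s0 + m * s0 / x"
  \<comment> \<open>The factor of \<open>Q\<close> in \<open>- sd Q / s - 2 a' Q + a s' Q / s\<close>, where \<open>a = c / x\<close>.\<close>
  define k where "k = - (sd / s) + (c * s' / s - 2 * c') / x + 2 * c / x^2"
  have QR: "Q = (e - e0) + R" by (simp add: Q R_def)
  have a: "s * LHS = Qd + Q * k - c / x * Q' + c0 * m * r / x^3"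
    unfolding LHS r k_def using x s by (simp add: field_simps power2_eq_square power3_eq_cube)
  have k: "k = - (sd0 / s0) + g1 + g0 / x - c2 + 2 * c0 / x^2"
    unfolding k_def cond3 c c' using x by (simp add: field_simps power2_eq_square)
  have b: "ed - ed0 - e1 * ld + (e - e0) * k - c / x * e' = c0 * e1 / s0 * (s0 / x - 2 * m * s0 - (t0 - s1))"
  proof -
    have "ed - ed0 - e1 * ld + (e - e0) * k - c / x * e' =
       (- (sd / s) * (e - e0) + ed - ed0 + (e - e0) / x * (c * s' / s - c') - e1 * (g0 - c1)
          + (2 * (c * e) - 2 * (c0 * e0) - ((c' * e + c * e') + (c1 * e0 + c0 * e1)) * x) / x^2)
       + (- e1 * (ld - g0 + c1) + c0 * e1 / x + e0 * (c' / x - 2 * (c - c0) / x^2 + c1 / x))"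
      unfolding k_def using x by (simp add: field_simps power2_eq_square)
    also have "e0 * (c' / x - 2 * (c - c0) / x^2 + c1 / x) = 0"
      unfolding c c' using x by (simp add: field_simps power2_eq_square)
    finally have "ed - ed0 - e1 * ld + (e - e0) * k - c / x * e' = - e1 * (ld - g0 + c1) + c0 * e1 / x"
      unfolding cond2[symmetric] by simp
    also have "\<dots> = c0 * e1 / s0 * (s0 / x - 2 * m * s0 - (t0 - s1))"
      using s0 x unfolding ld g0 by (simp add: field_simps)
    finally show ?thesis .
  qed
  have td0: "td0 = t0 * sd0 / s0 + s0 * f2 / 2" using td s0 by (simp add: field_simps power2_eq_square)
  have sd1': "sd1 = sd0 * s1 / s0 + s0 * g2 / 2" using sd1 s0 by (simp add: field_simps power2_eq_square)
  have "s * LHS - c0 * m * r / x^3 = (ed - ed0 - e1 * ld + (e - e0) * k - c / x * e') + R * k + c * m * s0 / x^3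
     + (- (md * (t0 - s1) + m * (td0 + t1 * ld - (sd1 + s2 * ld))) 
            - (2 * m * md * s0 + m^2 * (sd0 + s1 * ld)) + (md * s0 + m * (sd0 + s1 * ld)) / x + m * s0 * ld / x^2)"
    unfolding a Qd QR Q' using x by (simp add: field_simps power2_eq_square power3_eq_cube)
  then have "(s * LHS - c0 * m * r / x^3) * x^3 = (c0 * e1 / s0 * (s0 / x - 2 * m * s0 - (t0 - s1)) + R * k + c * m * s0 / x^3
     + (- (md * (t0 - s1) + m * (td0 + t1 * ld - (sd1 + s2 * ld))) 
            - (2 * m * md * s0 + m^2 * (sd0 + s1 * ld)) + (md * s0 + m * (sd0 + s1 * ld)) / x + m * s0 * ld / x^2)) * x^3"
    unfolding b by simp
  also have "\<dots> = - c0 * m * (- 3 * s0 + (t0 - 3 * s1) * x + (t1 - 3 / 2 * s2) * x^2 + (t2 / 2 - s3 / 2) * x^3)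
      + x^2 * W * (s0 - (t0 - s1 + 2 * m * s0) * x)" (is "?A = ?B")
  proof -
    \<comment> \<open>Measuring the values of \<open>\<sigma>\<close>, \<open>\<tau>\<close>, \<open>\<eta>\<close> at \<open>\<lambda>\<close> in units of \<open>s0\<close> makes the identity polynomial: all terms
      become \<open>s0\<close> times a polynomial in the rescaled values.\<close>
    define S1 S2 S3 where "S1 = s1 / s0" and "S2 = s2 / s0" and "S3 = s3 / s0"
    define T0 T1 T2 where "T0 = t0 / s0" and "T1 = t1 / s0" and "T2 = t2 / s0"
    define E1 V where "E1 = e1 / s0" and "V = sd0 / s0"
    have sub: "s1 = s0 * S1" "s2 = s0 * S2" "s3 = s0 * S3" "t0 = s0 * T0" "t1 = s0 * T1" "t2 = s0 * T2"
       "e1 = s0 * E1" "sd0 = s0 * V"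
      using s0 by (simp_all add: S1_def S2_def S3_def T0_def T1_def T2_def E1_def V_def)
    have g0': "g0 = c0 * S1" and g1': "g1 = c1 * S1 + c0 * S2 - c0 * S1^2"
      and f2': "f2 / 2 = c2 / 2 * T0 + c1 * T1 + c0 / 2 * T2 - (c1 * T0 + c0 * T1) * S1 - c0 / 2 * T0 * S2 + c0 * T0 * S1^2"
      and g2': "g2 / 2 = c2 / 2 * S1 + c1 * S2 + c0 / 2 * S3 - (c1 * S1 + c0 * S2) * S1 - c0 / 2 * S1 * S2 + c0 * S1^3"
      and ld': "ld = 2 * c0 * m - c1 + c0 * T0"
      and W': "W = md + c0 * E1 + m * (c0 * T1 - c0 / 2 * S2 - c2 / 2) + m^2 * (S1 * c0)"
      unfolding g0 g1 f2 g2 ld W sub using s0 by (simp_all add: field_simps power2_eq_square power3_eq_cube)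
    have td0': "td0 = s0 * (T0 * V + f2 / 2)" and sd1': "sd1 = s0 * (S1 * V + g2 / 2)"
      unfolding td0 sd1' sub using s0 by (simp_all add: field_simps)
    have "?A = (E1 * c0 * s0 * (1 - 2 * m * x - (T0 - S1) * x)) * x^2
       + s0 * (- m * (T0 - S1) * x - m^2 * x + m) * ((- V + g1 - c2) * x^2 + g0 * x + 2 * c0)
       + c * m * s0 - s0 * (md * (T0 - S1) + m * (T0 * V + f2 / 2 + T1 * ld - (S1 * V + g2 / 2 + S2 * ld))) * x^3
       - s0 * (2 * m * md + m^2 * (V + S1 * ld)) * x^3 + s0 * (md + m * (V + S1 * ld)) * x^2 + m * s0 * ld * x"
      unfolding k R_def td0' sd1' sub using x s0 by (simp add: field_simps power2_eq_square power3_eq_cube)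
    also have "\<dots> = ?B"
      unfolding f2' g2' ld' W' g0' g1' c sub by (simp add: field_simps power2_eq_square power3_eq_cube)
    finally show ?thesis .
  qed
  also have "(s * LHS - c0 * m * r / x^3) * x^3 = s * LHS * x^3 - c0 * m * r"
    using x by (simp add: left_diff_distrib)
  finally show ?thesis by (simp add: algebra_simps)
qed

section \<open>The compatibility conditions at a fixed time\<close>

lemma deriv_compat_a:
  assumes "z \<noteq> l"
  shows "deriv (compat_a C l) z = poly (pderiv C) z / (z - l) - poly C z / (z - l)\<^sup>2"
    and "(deriv ^^ 2) (compat_a C l) z
      = poly (pderiv (pderiv C)) z / (z - l) - 2 * poly (pderiv C) z / (z - l)\<^sup>2 + 2 * poly C z / (z - l)^3"
proof -
  have 1: "deriv (compat_a C l) x = poly (pderiv C) x / (x - l) - poly C x / (x - l)\<^sup>2" if "x \<noteq> l" for x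
    unfolding compat_a_def [abs_def] using that
    by (intro DERIV_imp_deriv)
       (auto intro!: derivative_eq_intros simp: diff_divide_distrib power2_eq_square)
  then show "deriv (compat_a C l) z = poly (pderiv C) z / (z - l) - poly C z / (z - l)\<^sup>2"
    using assms by blast
  have "deriv (deriv (compat_a C l)) z = deriv (\<lambda>x. poly (pderiv C) x / (x - l) - poly C x / (x - l)\<^sup>2) z"
    using assms 1 by (intro deriv_cong_ev) (auto simp: eventually_nhds intro!: exI[of _ "- {l}"])
  also have "\<dots> = poly (pderiv (pderiv C)) z / (z - l) - 2 * poly (pderiv C) z / (z - l)\<^sup>2 + 2 * poly C z / (z - l)^3"
  proof (rule DERIV_imp_deriv)
    have x: "z - l \<noteq> 0" using assms by simp
    show "((\<lambda>x. poly (pderiv C) x / (x - l) - poly C x / (x - l)\<^sup>2) has_field_derivative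
      poly (pderiv (pderiv C)) z / (z - l) - 2 * poly (pderiv C) z / (z - l)\<^sup>2 + 2 * poly C z / (z - l)^3) (at z)"
      by (rule derivative_eq_intros poly_DERIV refl | use x in force)+
         (use x in \<open>simp add: divide_simps power2_eq_square power3_eq_cube, simp add: algebra_simps\<close>)
  qed
  finally show "(deriv ^^ 2) (compat_a C l) z = \<dots>"
    by (simp add: numeral_2_eq_2)
qed

lemma deriv_compat_b:
  assumes "z \<noteq> l"
  shows "deriv (compat_b C l m) z = poly C l * m / (z - l)\<^sup>2"
    and "(deriv ^^ 2) (compat_b C l m) z = - 2 * poly C l * m / (z - l)^3"
proof -
  have 1: "deriv (compat_b C l m) x = poly C l * m / (x - l)\<^sup>2" if "x \<noteq> l" for x
    unfolding compat_b_def [abs_def] using that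
    by (intro DERIV_imp_deriv) (auto intro!: derivative_eq_intros simp: power2_eq_square)
  then show "deriv (compat_b C l m) z = poly C l * m / (z - l)\<^sup>2"
    using assms by blast
  have "deriv (deriv (compat_b C l m)) z = deriv (\<lambda>x. poly C l * m / (x - l)\<^sup>2) z"
    using assms 1 by (intro deriv_cong_ev) (auto simp: eventually_nhds intro!: exI[of _ "- {l}"])
  also have "\<dots> = - 2 * poly C l * m / (z - l)^3"
    using assms by (intro DERIV_imp_deriv)
      (auto intro!: derivative_eq_intros simp: divide_simps power2_eq_square power3_eq_cube)
  finally show "(deriv ^^ 2) (compat_b C l m) z = \<dots>"
    by (simp add: numeral_2_eq_2)
qed

text \<open>
  The situation at one time: \<open>U\<close> is a neighbourhood of the parameter \<open>l\<close> where everything is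
  holomorphic and \<open>\<sigma>\<close> has no zero, and the families are only used through their values and
  time derivatives at the time \<open>t\<close>.
\<close>

locale compatibility_point =
  fixes \<sigma> \<tau> \<eta> :: "complex \<Rightarrow> complex \<Rightarrow> complex" and C :: "complex poly"
    and t l :: complex and U :: "complex set"
  assumes open_U: "open U" and l_in: "l \<in> U"
    and hol: "\<sigma> t holomorphic_on U" "\<tau> t holomorphic_on U" "\<eta> t holomorphic_on U"
    and hol_dot: "dot \<sigma> t holomorphic_on U" "dot \<tau> t holomorphic_on U"
    and \<sigma>_nz: "\<And>z. z \<in> U \<Longrightarrow> \<sigma> t z \<noteq> 0"
    and degree_C: "degree C \<le> 2"
    and cond_\<tau>: "\<And>z. z \<in> U \<Longrightarrow> z \<noteq> l \<Longrightarrow> condition_tau \<sigma> \<tau> C t l z"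
    and cond_\<eta>: "\<And>z. z \<in> U \<Longrightarrow> z \<noteq> l \<Longrightarrow> condition_eta \<sigma> \<eta> C t l z"
    and cond_\<sigma>: "\<And>z. z \<in> U \<Longrightarrow> z \<noteq> l \<Longrightarrow> condition_sigma \<sigma> C t l z"
begin

lemma has_derivs:
  assumes "z \<in> U"
  shows "(\<sigma> t has_field_derivative deriv (\<sigma> t) z) (at z)"
    "(\<tau> t has_field_derivative deriv (\<tau> t) z) (at z)"
    "(\<eta> t has_field_derivative deriv (\<eta> t) z) (at z)"
    "(dot \<sigma> t has_field_derivative deriv (dot \<sigma> t) z) (at z)"
  using assms hol hol_dot open_U by (auto intro: holomorphic_derivI)

lemma condition_tau_limit:
  "dot \<tau> t l / \<sigma> t l - \<tau> t l * dot \<sigma> t l / (\<sigma> t l)\<^sup>2 = deriv (deriv (\<lambda>x. poly C x * \<tau> t x / \<sigma> t x)) l / 2"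
  by (rule second_order_limit[OF open_U l_in])
     (use cond_\<tau> \<sigma>_nz in \<open>auto simp: condition_tau_def Let_def intro!: holomorphic_intros hol hol_dot\<close>)

lemma condition_sigma_limit:
  "deriv (dot \<sigma> t) l / \<sigma> t l - dot \<sigma> t l * deriv (\<sigma> t) l / (\<sigma> t l)\<^sup>2
     = deriv (deriv (\<lambda>x. poly C x * deriv (\<sigma> t) x / \<sigma> t x)) l / 2"
proof -
  have "deriv (\<lambda>z. dot \<sigma> t z / \<sigma> t z) l = deriv (deriv (\<lambda>x. poly C x * deriv (\<sigma> t) x / \<sigma> t x)) l / 2"
    by (rule first_order_limit[OF open_U l_in])
       (use cond_\<sigma> \<sigma>_nz in \<open>auto simp: condition_sigma_def Let_def open_U intro!: holomorphic_intros hol hol_dot\<close>)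
  moreover have "deriv (\<lambda>z. dot \<sigma> t z / \<sigma> t z) l
      = deriv (dot \<sigma> t) l / \<sigma> t l - dot \<sigma> t l * deriv (\<sigma> t) l / (\<sigma> t l)\<^sup>2"
    using \<sigma>_nz[OF l_in]
    by (intro DERIV_imp_deriv DERIV_cong[OF DERIV_divide[OF has_derivs(4)[OF l_in] has_derivs(1)[OF l_in]]])
       (auto simp: field_simps power2_eq_square)
  ultimately show ?thesis by simp
qed

lemma deriv_deformed_p:
  assumes "z \<in> U" "z \<noteq> l"
  shows "deriv (deformed_p \<sigma> \<tau> t l) z
     = deriv (\<tau> t) z / \<sigma> t z - \<tau> t z * deriv (\<sigma> t) z / (\<sigma> t z)\<^sup>2 + 1 / (z - l)\<^sup>2"
proof (rule DERIV_imp_deriv)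
  note d = has_derivs[OF assms(1)]
  show "(deformed_p \<sigma> \<tau> t l has_field_derivative
     deriv (\<tau> t) z / \<sigma> t z - \<tau> t z * deriv (\<sigma> t) z / (\<sigma> t z)\<^sup>2 + 1 / (z - l)\<^sup>2) (at z)"
    unfolding deformed_p_def [abs_def] using assms(2) \<sigma>_nz[OF assms(1)]
    by (auto intro!: derivative_eq_intros d simp: diff_divide_distrib power2_eq_square)
qed

lemma deriv_deformed_q:
  assumes "z \<in> U" "z \<noteq> l"
  shows "deriv (deformed_q \<sigma> \<tau> \<eta> t l m) z
     = (deriv (\<eta> t) z - m * \<sigma> t l / (z - l)\<^sup>2) / \<sigma> t z
       - deriv (\<sigma> t) z * (\<eta> t z - \<eta> t l - m * (\<tau> t l - deriv (\<sigma> t) l) - m\<^sup>2 * \<sigma> t l + m * \<sigma> t l / (z - l)) / (\<sigma> t z)\<^sup>2"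
     (is "_ = ?d")
proof (rule DERIV_imp_deriv)
  note d = has_derivs[OF assms(1)]
  have "((\<lambda>z. \<eta> t z - \<eta> t l - m * (\<tau> t l - deriv (\<sigma> t) l) - m\<^sup>2 * \<sigma> t l + m * \<sigma> t l / (z - l))
      has_field_derivative deriv (\<eta> t) z - m * \<sigma> t l / (z - l)\<^sup>2) (at z)" (is "(?Q has_field_derivative _) _")
    using assms(2) by (auto intro!: derivative_eq_intros d simp: power2_eq_square)
  then have "((\<lambda>z. ?Q z / \<sigma> t z) has_field_derivative ?d) (at z)"
    by (rule DERIV_cong[OF DERIV_divide[OF _ d(1) \<sigma>_nz[OF assms(1)]]])
       (use \<sigma>_nz[OF assms(1)] in \<open>simp add: diff_divide_distrib power2_eq_square mult.commute\<close>)
  then show "(deformed_q \<sigma> \<tau> \<eta> t l m has_field_derivative ?d) (at z)"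
    unfolding deformed_q_def [abs_def] by simp
qed

text \<open>
  Here \<open>pd\<close> is the time derivative of \<open>p\<close> when \<open>ld\<close> is that of \<open>\<lambda>\<close>. Only the double pole survives: the
  condition on \<open>\<tau>\<close> says that the time derivative of \<open>\<tau> / \<sigma>\<close> cancels the part of \<open>a p' + p a'\<close> that
  comes from \<open>\<tau> / \<sigma>\<close>, up to the value of \<open>c \<tau> / \<sigma>\<close> at \<open>\<lambda>\<close>.
\<close>

lemma first_compatibility:
  assumes z: "z \<in> U" "z \<noteq> l"
    and pd: "pd = dot \<tau> t z / \<sigma> t z - \<tau> t z * dot \<sigma> t z / (\<sigma> t z)\<^sup>2 - ld / (z - l)\<^sup>2"
  shows "pd - compat_a C l z * deriv (deformed_p \<sigma> \<tau> t l) z + 2 * deriv (compat_b C l m) z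
      - deformed_p \<sigma> \<tau> t l z * deriv (compat_a C l) z + (deriv ^^ 2) (compat_a C l) z
     = (2 * poly C l * m - poly (pderiv C) l + poly C l * \<tau> t l / \<sigma> t l - ld) / (z - l)\<^sup>2"
proof -
  define x where "x = z - l"
  have x: "x \<noteq> 0" using z by (simp add: x_def)
  note nz = \<sigma>_nz[OF z(1)]
  have f': "deriv (\<lambda>x. poly C x * \<tau> t x / \<sigma> t x) z = (poly (pderiv C) z * \<tau> t z + poly C z * deriv (\<tau> t) z) / \<sigma> t z
      - poly C z * \<tau> t z * deriv (\<sigma> t) z / (\<sigma> t z)\<^sup>2"
    using second_deriv_mult_divide(1)[OF open_U z(1), of "poly C" "\<tau> t" "\<sigma> t"] \<sigma>_nz hol
    by (simp add: DERIV_imp_deriv[OF poly_DERIV] holomorphic_intros)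
  define A B K where "A = \<tau> t z / \<sigma> t z"
    and "B = deriv (\<tau> t) z / \<sigma> t z - \<tau> t z * deriv (\<sigma> t) z / (\<sigma> t z)\<^sup>2"
    and "K = poly C l * \<tau> t l / \<sigma> t l"
  have pd': "pd = - (ld / x\<^sup>2) - (poly C z * A - K - x * (poly (pderiv C) z * A + poly C z * B)) / x\<^sup>2"
    using cond_\<tau>[OF z] nz unfolding condition_tau_def Let_def f' pd x_def[symmetric] A_def B_def K_def
    by (simp add: algebra_simps add_divide_distrib)
  have "pd - poly C z / x * (B + 1 / x\<^sup>2) + 2 * (poly C l * m / x\<^sup>2)
     - (A - 1 / x) * (poly (pderiv C) z / x - poly C z / x\<^sup>2)
     + (poly (pderiv (pderiv C)) z / x - 2 * poly (pderiv C) z / x\<^sup>2 + 2 * poly C z / x^3)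
     = (2 * poly C l * m - (poly (pderiv C) z - poly (pderiv (pderiv C)) z * x) + K - ld) / x\<^sup>2"
    unfolding pd' using x by (simp add: field_simps power2_eq_square power3_eq_cube)
  also have "poly (pderiv C) z - poly (pderiv (pderiv C)) z * x = poly (pderiv C) l"
    unfolding poly_quadratic_at(2)[OF degree_C, of z l] poly_quadratic_at(3)[OF degree_C, of z l] x_def
    by simp
  finally show ?thesis
    unfolding deriv_deformed_p[OF z] deriv_compat_a[OF z(2)] deriv_compat_b[OF z(2)]
      compat_a_def deformed_p_def x_def[symmetric] A_def B_def K_def .
qed

text \<open>
  The numerator of \<open>\<sigma> (p b' + b'') = c(\<lambda>) \<mu> (\<dots>) / (z - \<lambda>)\<^sup>3\<close>.
\<close>

definition pole_numerator :: "complex \<Rightarrow> complex" where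
  "pole_numerator z = (z - l) * \<tau> t z - 3 * \<sigma> t z"

lemma pole_numerator_holomorphic: "pole_numerator holomorphic_on U"
  unfolding pole_numerator_def [abs_def] by (intro holomorphic_intros hol)

lemma deriv_pole_numerator:
  shows "deriv pole_numerator l = \<tau> t l - 3 * deriv (\<sigma> t) l"
    and "deriv (deriv pole_numerator) l = 2 * deriv (\<tau> t) l - 3 * deriv (deriv (\<sigma> t)) l"
    and "deriv (deriv (deriv pole_numerator)) l
      = 3 * deriv (deriv (\<tau> t)) l - 3 * deriv (deriv (deriv (\<sigma> t))) l"
proof -
  note hol' = hol[THEN holomorphic_deriv, OF open_U]
  note hol'' = hol'[THEN holomorphic_deriv, OF open_U]
  note d = hol(1,2)[THEN holomorphic_derivI, OF open_U] hol'(1,2)[THEN holomorphic_derivI, OF open_U]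
    hol''(1,2)[THEN holomorphic_derivI, OF open_U]
  have 1: "deriv pole_numerator z = \<tau> t z + (z - l) * deriv (\<tau> t) z - 3 * deriv (\<sigma> t) z" if "z \<in> U" for z
    unfolding pole_numerator_def [abs_def] using that
    by (intro DERIV_imp_deriv) (auto intro!: derivative_eq_intros d)
  have "deriv (deriv pole_numerator) z
      = deriv (\<lambda>z. \<tau> t z + (z - l) * deriv (\<tau> t) z - 3 * deriv (\<sigma> t) z) z" if "z \<in> U" for z
    using that open_U 1 by (intro deriv_cong_ev) (auto simp: eventually_nhds)
  also have "\<dots> z = 2 * deriv (\<tau> t) z + (z - l) * deriv (deriv (\<tau> t)) z - 3 * deriv (deriv (\<sigma> t)) z"
    if "z \<in> U" for z
    using that by (intro DERIV_imp_deriv) (auto intro!: derivative_eq_intros d)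
  finally have 2: "deriv (deriv pole_numerator) z
      = 2 * deriv (\<tau> t) z + (z - l) * deriv (deriv (\<tau> t)) z - 3 * deriv (deriv (\<sigma> t)) z" if "z \<in> U" for z
    using that by blast
  have "deriv (deriv (deriv pole_numerator)) l
      = deriv (\<lambda>z. 2 * deriv (\<tau> t) z + (z - l) * deriv (deriv (\<tau> t)) z - 3 * deriv (deriv (\<sigma> t)) z) l"
    using l_in open_U 2 by (intro deriv_cong_ev) (auto simp: eventually_nhds)
  also have "\<dots> = 3 * deriv (deriv (\<tau> t)) l - 3 * deriv (deriv (deriv (\<sigma> t))) l"
    using l_in by (intro DERIV_imp_deriv) (auto intro!: derivative_eq_intros d)
  finally show "deriv (deriv (deriv pole_numerator)) l = \<dots>" .
  show "deriv pole_numerator l = \<tau> t l - 3 * deriv (\<sigma> t) l"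
    "deriv (deriv pole_numerator) l = 2 * deriv (\<tau> t) l - 3 * deriv (deriv (\<sigma> t)) l"
    using 1[OF l_in] 2[OF l_in] by simp_all
qed

lemma cubic_remainder_pole_numerator:
  "cubic_remainder pole_numerator l z = (z - l) * \<tau> t z - 3 * \<sigma> t z
     - (- 3 * \<sigma> t l + (\<tau> t l - 3 * deriv (\<sigma> t) l) * (z - l)
        + (deriv (\<tau> t) l - 3 / 2 * deriv (deriv (\<sigma> t)) l) * (z - l)\<^sup>2
        + (deriv (deriv (\<tau> t)) l / 2 - deriv (deriv (deriv (\<sigma> t))) l / 2) * (z - l)^3)"
  unfolding cubic_remainder_def deriv_pole_numerator by (simp add: pole_numerator_def field_simps)

text \<open>
  Here \<open>ld\<close>, \<open>md\<close>, \<open>qd\<close> and \<open>Qd\<close> are the time derivatives of \<open>\<lambda>\<close>, \<open>\<mu>\<close>, \<open>q\<close> and \<open>\<sigma> q\<close>, and \<open>W\<close> is the residual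
  of the equation for \<open>\<mu>\<close>. The equation for \<open>\<lambda>\<close> is assumed because \<open>ld\<close> enters \<open>Qd\<close> and has to cancel
  the double pole of the other terms. The factor \<open>W\<close> then appears both in the simple pole and in
  the constant term, since \<open>\<mu>\<close> enters \<open>\<sigma> q\<close> in both.
\<close>

lemma second_compatibility:
  assumes z: "z \<in> U" "z \<noteq> l"
    and ld: "ld = 2 * poly C l * m - poly (pderiv C) l + poly C l * \<tau> t l / \<sigma> t l"
    and Qd: "Qd = dot \<eta> t z - (dot \<eta> t l + deriv (\<eta> t) l * ld)
        - (md * (\<tau> t l - deriv (\<sigma> t) l)
           + m * (dot \<tau> t l + deriv (\<tau> t) l * ld - (deriv (dot \<sigma> t) l + deriv (deriv (\<sigma> t)) l * ld)))
        - (2 * m * md * \<sigma> t l + m\<^sup>2 * (dot \<sigma> t l + deriv (\<sigma> t) l * ld))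
        + (md * \<sigma> t l + m * (dot \<sigma> t l + deriv (\<sigma> t) l * ld)) / (z - l) + m * \<sigma> t l * ld / (z - l)\<^sup>2"
    and qd: "qd = Qd / \<sigma> t z - dot \<sigma> t z / \<sigma> t z * deformed_q \<sigma> \<tau> \<eta> t l m z"
    and W: "W = md + poly C l * deriv (\<eta> t) l / \<sigma> t l
        + m * (poly C l * deriv (\<tau> t) l / \<sigma> t l - poly C l * deriv (deriv (\<sigma> t)) l / (2 * \<sigma> t l)
               - poly (pderiv (pderiv C)) l / 2)
        + m\<^sup>2 * (deriv (\<sigma> t) l * poly C l / \<sigma> t l)"
  shows "\<sigma> t z * (qd + deformed_p \<sigma> \<tau> t l z * deriv (compat_b C l m) z
      - 2 * deformed_q \<sigma> \<tau> \<eta> t l m z * deriv (compat_a C l) z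
      - compat_a C l z * deriv (deformed_q \<sigma> \<tau> \<eta> t l m) z + (deriv ^^ 2) (compat_b C l m) z) * (z - l)^3
    = poly C l * m * cubic_remainder pole_numerator l z
      + (z - l)\<^sup>2 * W * (\<sigma> t l - (\<tau> t l - deriv (\<sigma> t) l + 2 * m * \<sigma> t l) * (z - l))"
proof -
  have x: "z - l \<noteq> 0" using z by simp
  note nz = \<sigma>_nz[OF z(1)] and nzl = \<sigma>_nz[OF l_in]
  note [simp] = DERIV_imp_deriv[OF poly_DERIV]
  have polys: "poly p holomorphic_on U" for p :: "complex poly"
    by (intro holomorphic_intros)
  have [simp]: "deriv (poly p) = poly (pderiv p)" for p :: "complex poly" by (rule ext) simp
  note hol' = hol[THEN holomorphic_deriv, OF open_U]
  have nzU: "\<forall>x\<in>U. \<sigma> t x \<noteq> 0" using \<sigma>_nz by blast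
  note f = second_deriv_mult_divide[OF open_U l_in polys[of C] hol(2) hol(1) nzU]
  note g = second_deriv_mult_divide[OF open_U l_in polys[of C] hol'(1) hol(1) nzU]
  have h: "deriv (\<lambda>x. poly C x * \<eta> t x) y = poly (pderiv C) y * \<eta> t y + poly C y * deriv (\<eta> t) y"
    if "y \<in> U" for y
    by (rule DERIV_imp_deriv) (auto intro!: derivative_eq_intros has_derivs(3)[OF that])
  show ?thesis
    unfolding cubic_remainder_pole_numerator
  proof (rule second_compatibility_algebra[where c = "poly C z" and c' = "poly (pderiv C) z" and s = "\<sigma> t z" and x = "z - l"
        and sd = "dot \<sigma> t z" and s' = "deriv (\<sigma> t) z" and e = "\<eta> t z" and e' = "deriv (\<eta> t) z"
        and ed = "dot \<eta> t z" and ?e0.0 = "\<eta> t l" and ?e1.0 = "deriv (\<eta> t) l" and ?ed0.0 = "dot \<eta> t l"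
        and t = "\<tau> t z" and r = "(z - l) * \<tau> t z - 3 * \<sigma> t z"
        and ?td0.0 = "dot \<tau> t l" and ?sd0.0 = "dot \<sigma> t l" and ?sd1.0 = "deriv (dot \<sigma> t) l"
        and m = m and ld = ld and md = md and Qd = Qd
        and ?g0.0 = "poly C l * deriv (\<sigma> t) l / \<sigma> t l"
        and ?g1.0 = "deriv (\<lambda>x. poly C x * deriv (\<sigma> t) x / \<sigma> t x) l",
        OF x nzl nz poly_quadratic_at(1,2)[OF degree_C] refl _ _ _
        condition_tau_limit condition_sigma_limit _ _ ld refl W refl Qd refl])
    show "deriv (\<lambda>x. poly C x * deriv (\<sigma> t) x / \<sigma> t x) l =
      (poly (pderiv C) l * deriv (\<sigma> t) l + poly C l * deriv (deriv (\<sigma> t)) l) / \<sigma> t l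
        - poly C l * (deriv (\<sigma> t) l)\<^sup>2 / (\<sigma> t l)\<^sup>2"
      unfolding g by (simp add: power2_eq_square)
    show "dot \<sigma> t z / \<sigma> t z = dot \<sigma> t l / \<sigma> t l + (poly C z * deriv (\<sigma> t) z / \<sigma> t z
        - poly C l * deriv (\<sigma> t) l / \<sigma> t l - deriv (\<lambda>x. poly C x * deriv (\<sigma> t) x / \<sigma> t x) l * (z - l)) / (z - l)"
      using cond_\<sigma>[OF z] unfolding condition_sigma_def Let_def by (simp add: algebra_simps)
  next
    show "0 = - (dot \<sigma> t z / \<sigma> t z) * (\<eta> t z - \<eta> t l) + dot \<eta> t z - dot \<eta> t l
      + (\<eta> t z - \<eta> t l) / (z - l) * (poly C z * deriv (\<sigma> t) z / \<sigma> t z - poly (pderiv C) z)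
      - deriv (\<eta> t) l * (poly C l * deriv (\<sigma> t) l / \<sigma> t l - poly (pderiv C) l)
      + (2 * (poly C z * \<eta> t z) - 2 * (poly C l * \<eta> t l)
         - (poly (pderiv C) z * \<eta> t z + poly C z * deriv (\<eta> t) z + (poly (pderiv C) l * \<eta> t l + poly C l * deriv (\<eta> t) l)) * (z - l))
        / (z - l)\<^sup>2"
      using cond_\<eta>[OF z] unfolding condition_eta_def Let_def h[OF z(1)] h[OF l_in]
      by (simp add: algebra_simps)
  next
    show "deriv (deriv (\<lambda>x. poly C x * \<tau> t x / \<sigma> t x)) l =
      (poly (pderiv (pderiv C)) l * \<tau> t l + 2 * poly (pderiv C) l * deriv (\<tau> t) l + poly C l * deriv (deriv (\<tau> t)) l) / \<sigma> t l
      - 2 * (poly (pderiv C) l * \<tau> t l + poly C l * deriv (\<tau> t) l) * deriv (\<sigma> t) l / (\<sigma> t l)\<^sup>2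
      - poly C l * \<tau> t l * deriv (deriv (\<sigma> t)) l / (\<sigma> t l)\<^sup>2
      + 2 * poly C l * \<tau> t l * (deriv (\<sigma> t) l)\<^sup>2 / (\<sigma> t l)^3"
      unfolding f by simp
    show "deriv (deriv (\<lambda>x. poly C x * deriv (\<sigma> t) x / \<sigma> t x)) l =
      (poly (pderiv (pderiv C)) l * deriv (\<sigma> t) l + 2 * poly (pderiv C) l * deriv (deriv (\<sigma> t)) l
        + poly C l * deriv (deriv (deriv (\<sigma> t))) l) / \<sigma> t l
      - 2 * (poly (pderiv C) l * deriv (\<sigma> t) l + poly C l * deriv (deriv (\<sigma> t)) l) * deriv (\<sigma> t) l / (\<sigma> t l)\<^sup>2
      - poly C l * deriv (\<sigma> t) l * deriv (deriv (\<sigma> t)) l / (\<sigma> t l)\<^sup>2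
      + 2 * poly C l * deriv (\<sigma> t) l * (deriv (\<sigma> t) l)\<^sup>2 / (\<sigma> t l)^3"
      unfolding g by simp
  next
    show "qd + deformed_p \<sigma> \<tau> t l z * deriv (compat_b C l m) z
      - 2 * deformed_q \<sigma> \<tau> \<eta> t l m z * deriv (compat_a C l) z
      - compat_a C l z * deriv (deformed_q \<sigma> \<tau> \<eta> t l m) z + (deriv ^^ 2) (compat_b C l m) z
     = Qd / \<sigma> t z - dot \<sigma> t z * (\<eta> t z - \<eta> t l - m * (\<tau> t l - deriv (\<sigma> t) l) - m\<^sup>2 * \<sigma> t l + m * \<sigma> t l / (z - l)) / (\<sigma> t z)\<^sup>2
      + (\<tau> t z / \<sigma> t z - 1 / (z - l)) * (poly C l * m / (z - l)\<^sup>2)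
      - 2 * ((\<eta> t z - \<eta> t l - m * (\<tau> t l - deriv (\<sigma> t) l) - m\<^sup>2 * \<sigma> t l + m * \<sigma> t l / (z - l)) / \<sigma> t z)
          * (poly (pderiv C) z / (z - l) - poly C z / (z - l)\<^sup>2)
      - poly C z / (z - l) * ((deriv (\<eta> t) z - m * \<sigma> t l / (z - l)\<^sup>2) / \<sigma> t z
          - deriv (\<sigma> t) z * (\<eta> t z - \<eta> t l - m * (\<tau> t l - deriv (\<sigma> t) l) - m\<^sup>2 * \<sigma> t l + m * \<sigma> t l / (z - l)) / (\<sigma> t z)\<^sup>2)
      - 2 * poly C l * m / (z - l)^3"
      unfolding qd deriv_deformed_q[OF z] deriv_compat_a[OF z(2)] deriv_compat_b[OF z(2)]
        deformed_q_def deformed_p_def compat_a_def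
      by (simp add: power2_eq_square)
  qed
qed

end

section \<open>Time derivatives along the moving singularity\<close>

lemma dot_deformed_p:
  assumes \<sigma>: "rational_family T Ns Ds \<sigma>" and \<tau>: "rational_family T Nt Dt \<tau>" and T: "open T" "t \<in> T"
    and nz: "poly (Ds t) z \<noteq> 0" "poly (Dt t) z \<noteq> 0" "\<sigma> t z \<noteq> 0" "z \<noteq> L t"
    and L: "(L has_field_derivative ld) (at t)"
  shows "dot (\<lambda>s. deformed_p \<sigma> \<tau> s (L s)) t z
     = dot \<tau> t z / \<sigma> t z - \<tau> t z * dot \<sigma> t z / (\<sigma> t z)\<^sup>2 - ld / (z - L t)\<^sup>2"
  unfolding dot_def deformed_p_def
proof (fold dot_def, rule DERIV_imp_deriv)
  have d\<sigma>: "((\<lambda>s. \<sigma> s z) has_field_derivative dot \<sigma> t z) (at t)"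
    using rational_family_chain_rule[OF \<sigma> T, of "\<lambda>_. z" 0] nz by simp
  have d\<tau>: "((\<lambda>s. \<tau> s z) has_field_derivative dot \<tau> t z) (at t)"
    using rational_family_chain_rule[OF \<tau> T, of "\<lambda>_. z" 0] nz by simp
  show "((\<lambda>s. \<tau> s z / \<sigma> s z - 1 / (z - L s)) has_field_derivative
      dot \<tau> t z / \<sigma> t z - \<tau> t z * dot \<sigma> t z / (\<sigma> t z)\<^sup>2 - ld / (z - L t)\<^sup>2) (at t)"
    using nz by (auto intro!: derivative_eq_intros d\<sigma> d\<tau> L simp: diff_divide_distrib power2_eq_square)
qed

text \<open>
  The family \<open>\<sigma>'\<close> is evaluated at the moving point, hence its time derivative at \<open>\<lambda>\<close> appears first as
  the mixed partial derivative of \<open>\<sigma>\<close> in one order; it is stated in the other order, since the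
  condition on \<open>\<sigma>\<close> determines the z-derivative of \<open>dot \<sigma> t / \<sigma> t\<close> at \<open>\<lambda>\<close>.
\<close>

lemma dot_deformed_q:
  assumes \<sigma>: "rational_family T Ns Ds \<sigma>" and \<tau>: "rational_family T Nt Dt \<tau>"
    and \<eta>: "rational_family T Ne De \<eta>" and T: "open T" "t \<in> T"
    and z: "poly (Ds t) z \<noteq> 0" "poly (De t) z \<noteq> 0" "\<sigma> t z \<noteq> 0" "z \<noteq> L t"
    and l: "poly (Ds t) (L t) \<noteq> 0" "poly (Dt t) (L t) \<noteq> 0" "poly (De t) (L t) \<noteq> 0"
    and L: "(L has_field_derivative ld) (at t)" and M: "(M has_field_derivative md) (at t)"
  shows "dot (\<lambda>s. deformed_q \<sigma> \<tau> \<eta> s (L s) (M s)) t z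
     = (dot \<eta> t z - (dot \<eta> t (L t) + deriv (\<eta> t) (L t) * ld)
        - (md * (\<tau> t (L t) - deriv (\<sigma> t) (L t))
           + M t * (dot \<tau> t (L t) + deriv (\<tau> t) (L t) * ld
                    - (deriv (dot \<sigma> t) (L t) + deriv (deriv (\<sigma> t)) (L t) * ld)))
        - (2 * M t * md * \<sigma> t (L t) + (M t)\<^sup>2 * (dot \<sigma> t (L t) + deriv (\<sigma> t) (L t) * ld))
        + (md * \<sigma> t (L t) + M t * (dot \<sigma> t (L t) + deriv (\<sigma> t) (L t) * ld)) / (z - L t)
        + M t * \<sigma> t (L t) * ld / (z - L t)\<^sup>2) / \<sigma> t z
       - dot \<sigma> t z / \<sigma> t z * deformed_q \<sigma> \<tau> \<eta> t (L t) (M t) z"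
    (is "_ = ?Qd / _ - _")
  unfolding dot_def[of "\<lambda>s. deformed_q \<sigma> \<tau> \<eta> s (L s) (M s)"]
proof (rule DERIV_imp_deriv)
  have d\<sigma>: "((\<lambda>s. \<sigma> s z) has_field_derivative dot \<sigma> t z) (at t)"
    using rational_family_chain_rule[OF \<sigma> T, of "\<lambda>_. z" 0] z by simp
  have d\<eta>: "((\<lambda>s. \<eta> s z) has_field_derivative dot \<eta> t z) (at t)"
    using rational_family_chain_rule[OF \<eta> T, of "\<lambda>_. z" 0] z by simp
  note d\<sigma>l = rational_family_chain_rule[OF \<sigma> T l(1) L] and d\<tau>l = rational_family_chain_rule[OF \<tau> T l(2) L]
    and d\<eta>l = rational_family_chain_rule[OF \<eta> T l(3) L]
  have l': "poly ((Ds t)\<^sup>2) (L t) \<noteq> 0" using l by simp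
  note d\<sigma>'l = rational_family_chain_rule[OF rational_family_deriv[OF \<sigma>] T l' L,
      unfolded rational_family_mixed_partials[OF \<sigma> T l(1)]]
  have x: "z - L t \<noteq> 0" using z by simp
  define Q where "Q s = \<eta> s z - \<eta> s (L s) - M s * (\<tau> s (L s) - deriv (\<sigma> s) (L s)) - (M s)\<^sup>2 * \<sigma> s (L s)
      + M s * \<sigma> s (L s) / (z - L s)" for s
  have Q: "(Q has_field_derivative ?Qd) (at t)"
    unfolding Q_def
    by (rule derivative_eq_intros d\<eta> d\<sigma>l d\<tau>l d\<eta>l d\<sigma>'l L M x refl)+
       (use x in \<open>simp add: add_divide_distrib power2_eq_square distrib_left mult_ac\<close>)
  have "((\<lambda>s. Q s / \<sigma> s z) has_field_derivative ?Qd / \<sigma> t z - dot \<sigma> t z / \<sigma> t z * (Q t / \<sigma> t z)) (at t)"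
    by (rule DERIV_cong[OF DERIV_divide[OF Q d\<sigma> z(3)]])
       (use z in \<open>simp add: diff_divide_distrib mult_ac\<close>)
  then show "((\<lambda>s. deformed_q \<sigma> \<tau> \<eta> s (L s) (M s) z) has_field_derivative
      ?Qd / \<sigma> t z - dot \<sigma> t z / \<sigma> t z * deformed_q \<sigma> \<tau> \<eta> t (L t) (M t) z) (at t)"
    unfolding deformed_q_def Q_def by simp
qed

lemma open_regular_points:
  assumes \<sigma>: "rational_family T Ns Ds \<sigma>" and t: "t \<in> T"
  shows "open {z. regular_point Ds Dt De \<sigma> t z}"
proof -
  have "open {z. poly (Ds t) z \<noteq> 0}"
    by (intro open_Collect_neq continuous_intros)
  then have "open ({z. poly (Ds t) z \<noteq> 0} \<inter> \<sigma> t -` (- {0}))"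
    using rational_family_holomorphic[OF \<sigma> t]
    by (intro continuous_open_preimage holomorphic_on_imp_continuous_on) auto
  moreover have "open {z. poly (Dt t) z \<noteq> 0}" "open {z. poly (De t) z \<noteq> 0}"
    by (intro open_Collect_neq continuous_intros)+
  ultimately have "open (({z. poly (Ds t) z \<noteq> 0} \<inter> \<sigma> t -` (- {0})) \<inter> ({z. poly (Dt t) z \<noteq> 0} \<inter> {z. poly (De t) z \<noteq> 0}))"
    by (rule open_Int[OF _ open_Int])
  also have "\<dots> = {z. regular_point Ds Dt De \<sigma> t z}"
    by (auto simp: regular_point_def)
  finally show ?thesis .
qed

lemma compatibility_point_regular_points:
  assumes T: "open T" "t \<in> T" and \<sigma>: "rational_family T Ns Ds \<sigma>" and \<tau>: "rational_family T Nt Dt \<tau>"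
    and \<eta>: "rational_family T Ne De \<eta>"
    and l: "regular_point Ds Dt De \<sigma> t l" and C: "degree C \<le> 2"
    and conds: "\<And>z. regular_point Ds Dt De \<sigma> t z \<Longrightarrow> z \<noteq> l \<Longrightarrow> condition_tau \<sigma> \<tau> C t l z"
      "\<And>z. regular_point Ds Dt De \<sigma> t z \<Longrightarrow> z \<noteq> l \<Longrightarrow> condition_eta \<sigma> \<eta> C t l z"
      "\<And>z. regular_point Ds Dt De \<sigma> t z \<Longrightarrow> z \<noteq> l \<Longrightarrow> condition_sigma \<sigma> C t l z"
  shows "compatibility_point \<sigma> \<tau> \<eta> C t l {z. regular_point Ds Dt De \<sigma> t z}"
proof
  show "open {z. regular_point Ds Dt De \<sigma> t z}"
    by (rule open_regular_points[OF \<sigma> T(2)])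
  show "\<sigma> t holomorphic_on {z. regular_point Ds Dt De \<sigma> t z}"
    by (rule holomorphic_on_subset[OF rational_family_holomorphic[OF \<sigma> T(2)]]) (auto simp: regular_point_def)
  show "\<tau> t holomorphic_on {z. regular_point Ds Dt De \<sigma> t z}"
    by (rule holomorphic_on_subset[OF rational_family_holomorphic[OF \<tau> T(2)]]) (auto simp: regular_point_def)
  show "\<eta> t holomorphic_on {z. regular_point Ds Dt De \<sigma> t z}"
    by (rule holomorphic_on_subset[OF rational_family_holomorphic[OF \<eta> T(2)]]) (auto simp: regular_point_def)
  show "dot \<sigma> t holomorphic_on {z. regular_point Ds Dt De \<sigma> t z}"
    by (rule holomorphic_on_subset[OF rational_family_holomorphic[OF rational_family_dot[OF \<sigma> T(1)] T(2)]])
       (auto simp: regular_point_def)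
  show "dot \<tau> t holomorphic_on {z. regular_point Ds Dt De \<sigma> t z}"
    by (rule holomorphic_on_subset[OF rational_family_holomorphic[OF rational_family_dot[OF \<tau> T(1)] T(2)]])
       (auto simp: regular_point_def)
qed (use l C conds in \<open>auto simp: regular_point_def\<close>)

section \<open>Equivalence with the equations of motion\<close>

theorem theorem4p1:
  fixes T :: "complex set"
    and Par :: "(complex \<times> complex) set"
    and Ns Ds Nt Dt Ne De :: "complex \<Rightarrow> complex poly"
    and \<sigma> \<tau> \<eta> :: "complex \<Rightarrow> complex \<Rightarrow> complex"
    and c :: "complex \<Rightarrow> complex \<Rightarrow> complex poly"
    and L M :: "complex \<Rightarrow> complex"
  defines "p \<equiv> \<lambda>t. deformed_p \<sigma> \<tau> t (L t)"
    and "q \<equiv> \<lambda>t. deformed_q \<sigma> \<tau> \<eta> t (L t) (M t)"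
    and "a \<equiv> \<lambda>t. compat_a (c t (L t)) (L t)"
    and "b \<equiv> \<lambda>t. compat_b (c t (L t)) (L t) (M t)"
  assumes T: "open T"
    and sigma: "rational_family T Ns Ds \<sigma>"
    and tau: "rational_family T Nt Dt \<tau>"
    and eta: "rational_family T Ne De \<eta>"
    and parameters: "\<And>t l. (t, l) \<in> Par \<Longrightarrow> t \<in> T \<and> regular_point Ds Dt De \<sigma> t l"
    and c: "\<And>t l. (t, l) \<in> Par \<Longrightarrow> degree (c t l) \<le> 2"
    and condition1: "\<And>t l z. (t, l) \<in> Par \<Longrightarrow> regular_point Ds Dt De \<sigma> t z \<Longrightarrow> z \<noteq> l \<Longrightarrow>
                       condition_tau \<sigma> \<tau> (c t l) t l z"
    and condition2: "\<And>t l z. (t, l) \<in> Par \<Longrightarrow> regular_point Ds Dt De \<sigma> t z \<Longrightarrow> z \<noteq> l \<Longrightarrow>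
                       condition_eta \<sigma> \<eta> (c t l) t l z"
    and condition3: "\<And>t l z. (t, l) \<in> Par \<Longrightarrow> regular_point Ds Dt De \<sigma> t z \<Longrightarrow> z \<noteq> l \<Longrightarrow>
                       condition_sigma \<sigma> (c t l) t l z"
    and L: "L holomorphic_on T" "\<And>t. t \<in> T \<Longrightarrow> (t, L t) \<in> Par"
    and M: "M holomorphic_on T"
  shows "((\<forall>t\<in>T. heun_type Ds Dt De \<sigma> \<tau> t (L t)) \<longrightarrow>
            ((\<forall>t\<in>T. lambda_equation \<sigma> \<tau> c L M t \<and> mu_equation \<sigma> \<tau> \<eta> c L M t) \<longleftrightarrow>
             (\<forall>t\<in>T. \<forall>z. regular_point Ds Dt De \<sigma> t z \<and> z \<noteq> L t \<longrightarrow>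
                 compatible_at p q (a t) (b t) t z)))
       \<and> ((\<forall>t\<in>T. \<forall>z. regular_point Ds Dt De \<sigma> t z \<and> z \<noteq> L t \<longrightarrow>
                 compatible_at p q (a t) (b t) t z) \<longrightarrow>
          (\<forall>t\<in>T. lambda_equation \<sigma> \<tau> c L M t \<and> mu_equation \<sigma> \<tau> \<eta> c L M t))"

proof -
  define U where "U t = {z. regular_point Ds Dt De \<sigma> t z}" for t
  define W where "W t = deriv M t + poly (c t (L t)) (L t) * deriv (\<eta> t) (L t) / \<sigma> t (L t)
        + M t * (poly (c t (L t)) (L t) * deriv (\<tau> t) (L t) / \<sigma> t (L t)
               - poly (c t (L t)) (L t) * deriv (deriv (\<sigma> t)) (L t) / (2 * \<sigma> t (L t))
               - poly (pderiv (pderiv (c t (L t)))) (L t) / 2)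
        + (M t)\<^sup>2 * (deriv (\<sigma> t) (L t) * poly (c t (L t)) (L t) / \<sigma> t (L t))" for t
  have mu_iff: "mu_equation \<sigma> \<tau> \<eta> c L M t \<longleftrightarrow> W t = 0" for t
    unfolding mu_equation_def Let_def W_def by (simp add: numeral_2_eq_2 eq_iff_diff_eq_0[of "deriv M t"] algebra_simps)
  have point: "compatibility_point \<sigma> \<tau> \<eta> (c t (L t)) t (L t) (U t)" if t: "t \<in> T" for t
    unfolding U_def using parameters[OF L(2)[OF t]] c[OF L(2)[OF t]]
      condition1[OF L(2)[OF t]] condition2[OF L(2)[OF t]] condition3[OF L(2)[OF t]]
    by (intro compatibility_point_regular_points[OF T t sigma tau eta]) auto
  have dL: "(L has_field_derivative deriv L t) (at t)" and dM: "(M has_field_derivative deriv M t) (at t)"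
    if "t \<in> T" for t
    using that L(1) M T by (auto intro: holomorphic_derivI)
  have l: "regular_point Ds Dt De \<sigma> t (L t)" if "t \<in> T" for t
    using parameters[OF L(2)[OF that]] by blast
  have first: "dot p t z - a t z * deriv (p t) z + 2 * deriv (b t) z - p t z * deriv (a t) z + (deriv ^^ 2) (a t) z = 0
      \<longleftrightarrow> lambda_equation \<sigma> \<tau> c L M t" if t: "t \<in> T" and z: "z \<in> U t" "z \<noteq> L t" for t z
  proof -
    interpret compatibility_point \<sigma> \<tau> \<eta> "c t (L t)" t "L t" "U t" by (rule point[OF t])
    have "dot p t z = dot \<tau> t z / \<sigma> t z - \<tau> t z * dot \<sigma> t z / (\<sigma> t z)\<^sup>2 - deriv L t / (z - L t)\<^sup>2"
      unfolding p_def by (rule dot_deformed_p[OF sigma tau T t])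
        (use z dL[OF t] in \<open>auto simp: U_def regular_point_def\<close>)
    from first_compatibility[OF z this, of "M t"] show ?thesis
      using z unfolding p_def a_def b_def lambda_equation_def Let_def by auto
  qed
  have second: "\<sigma> t z * (dot q t z + p t z * deriv (b t) z - 2 * q t z * deriv (a t) z - a t z * deriv (q t) z
        + (deriv ^^ 2) (b t) z) * (z - L t)^3
      = poly (c t (L t)) (L t) * M t * cubic_remainder (\<lambda>z. (z - L t) * \<tau> t z - 3 * \<sigma> t z) (L t) z
        + (z - L t)\<^sup>2 * (W t * \<sigma> t (L t)
            - W t * (\<tau> t (L t) - deriv (\<sigma> t) (L t) + 2 * M t * \<sigma> t (L t)) * (z - L t))"
    if t: "t \<in> T" and z: "z \<in> U t" "z \<noteq> L t" and lam: "lambda_equation \<sigma> \<tau> c L M t" for t z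
  proof -
    interpret compatibility_point \<sigma> \<tau> \<eta> "c t (L t)" t "L t" "U t" by (rule point[OF t])
    have ld: "deriv L t = 2 * poly (c t (L t)) (L t) * M t - poly (pderiv (c t (L t))) (L t)
        + poly (c t (L t)) (L t) * \<tau> t (L t) / \<sigma> t (L t)"
      using lam unfolding lambda_equation_def Let_def .
    have qd: "dot q t z
     = (dot \<eta> t z - (dot \<eta> t (L t) + deriv (\<eta> t) (L t) * deriv L t)
        - (deriv M t * (\<tau> t (L t) - deriv (\<sigma> t) (L t))
           + M t * (dot \<tau> t (L t) + deriv (\<tau> t) (L t) * deriv L t
                    - (deriv (dot \<sigma> t) (L t) + deriv (deriv (\<sigma> t)) (L t) * deriv L t)))
        - (2 * M t * deriv M t * \<sigma> t (L t) + (M t)\<^sup>2 * (dot \<sigma> t (L t) + deriv (\<sigma> t) (L t) * deriv L t))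
        + (deriv M t * \<sigma> t (L t) + M t * (dot \<sigma> t (L t) + deriv (\<sigma> t) (L t) * deriv L t)) / (z - L t)
        + M t * \<sigma> t (L t) * deriv L t / (z - L t)\<^sup>2) / \<sigma> t z
       - dot \<sigma> t z / \<sigma> t z * deformed_q \<sigma> \<tau> \<eta> t (L t) (M t) z"
      unfolding q_def by (rule dot_deformed_q[OF sigma tau eta T t])
        (use z dL[OF t] dM[OF t] l[OF t] in \<open>auto simp: U_def regular_point_def\<close>)
    show ?thesis
      using second_compatibility[OF z ld refl qd W_def]
      unfolding p_def q_def a_def b_def pole_numerator_def [abs_def] by (simp add: algebra_simps)
  qed
  have forward: "compatible_at p q (a t) (b t) t z"
    if t: "t \<in> T" and z: "regular_point Ds Dt De \<sigma> t z" "z \<noteq> L t" and heun: "heun_type Ds Dt De \<sigma> \<tau> t (L t)"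
      and eqs: "lambda_equation \<sigma> \<tau> c L M t" "mu_equation \<sigma> \<tau> \<eta> c L M t" for t z
  proof -
    interpret compatibility_point \<sigma> \<tau> \<eta> "c t (L t)" t "L t" "U t" by (rule point[OF t])
    have z': "z \<in> U t" using z by (simp add: U_def)
    obtain r where "degree r \<le> 3" "\<And>z. z \<in> U t \<Longrightarrow> (z - L t) * \<tau> t z - 3 * \<sigma> t z = poly r z"
      using heun by (auto simp: heun_type_def U_def)
    then have "cubic_remainder (\<lambda>z. (z - L t) * \<tau> t z - 3 * \<sigma> t z) (L t) z = 0"
      by (intro cubic_remainder_poly[OF open_U l_in z']) auto
    then have "dot q t z + p t z * deriv (b t) z - 2 * q t z * deriv (a t) z - a t z * deriv (q t) z
        + (deriv ^^ 2) (b t) z = 0"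
      using second[OF t z' z(2) eqs(1)] eqs(2) \<sigma>_nz[OF z'] z(2) by (simp add: mu_iff)
    with first[OF t z' z(2)] eqs(1) show ?thesis
      unfolding compatible_at_def by blast
  qed
  have backward: "lambda_equation \<sigma> \<tau> c L M t \<and> mu_equation \<sigma> \<tau> \<eta> c L M t"
    if t: "t \<in> T" and compat: "\<forall>z. regular_point Ds Dt De \<sigma> t z \<and> z \<noteq> L t \<longrightarrow> compatible_at p q (a t) (b t) t z" for t
  proof
    interpret compatibility_point \<sigma> \<tau> \<eta> "c t (L t)" t "L t" "U t" by (rule point[OF t])
    have compat': "compatible_at p q (a t) (b t) t z" if "z \<in> U t" "z \<noteq> L t" for z
      using that compat by (simp add: U_def)
    \<comment> \<open>The first condition at a single point other than \<open>\<lambda>\<close> already gives the equation for \<open>\<lambda>\<close>.\<close>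
    have "U t \<noteq> {L t}" using open_U not_open_singleton by metis
    then obtain z where z: "z \<in> U t" "z \<noteq> L t" using l_in by blast
    show lam: "lambda_equation \<sigma> \<tau> c L M t"
      using first[OF t z] compat'[OF z] unfolding compatible_at_def by blast
    have "W t * \<sigma> t (L t) = 0"
    proof (rule quadratic_coefficient_eq_0[OF open_U l_in pole_numerator_holomorphic])
      fix z assume z: "z \<in> U t" "z \<noteq> L t"
      show "poly (c t (L t)) (L t) * M t * cubic_remainder pole_numerator (L t) z
        + (z - L t)\<^sup>2 * (W t * \<sigma> t (L t)
            - W t * (\<tau> t (L t) - deriv (\<sigma> t) (L t) + 2 * M t * \<sigma> t (L t)) * (z - L t)) = 0"
        using second[OF t z lam] compat'[OF z] unfolding compatible_at_def pole_numerator_def [abs_def]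
        by simp
    qed
    then show "mu_equation \<sigma> \<tau> \<eta> c L M t"
      using \<sigma>_nz[OF l_in] by (simp add: mu_iff)
  qed
  show ?thesis
    using forward backward by blast
qed

end
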